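(* Let $X$ be a separable infinite dimensional $\mathcal{L}_\infty$-space and let $N\subset X$ be a net in $X$. Then $N$ (with the metric inherited from $X$) has a retractional basis.
   Context: Banach spaces are real. A Banach space $X$ is an $\mathcal{L}_{\infty,\lambda}$-space ($\lambda\ge 1$) if for every finite dimensional subspace $F$ of $X$ there is a finite dimensional subspace $G$ of $X$ containing $F$ and $\lambda$-isomorphic to $\ell_\infty^n$, $n=\dim G$; $X$ is an $\mathcal{L}_\infty$-space if it is an $\mathcal{L}_{\infty,\lambda}$-space for some $\lambda\ge1$. A subset $N$ of a metric space $(Y,d)$ is a net if there are $a,b>0$ such that $d(x,y)\ge a$ for all distinct $x,y\in N$, and for every $x\in Y$ there is $y\in N$ with $d(x,y)\le b$. Let $M$ be a countable metric space and $K\ge 1$. A $K$-retractional basis of $M$ is a sequence of retractions $\varphi_n:M\to M$ ($n\in\mathbb{N}$), for which there is a sequence $(x_j)_{j\in\mathbb{N}}$ in $M$, such that (1) $\varphi_n(M)=\{x_1,\dots,x_n\}$ for every $n$; (2) $\bigcup_{j}\{x_j\}=M$; (3) every $\varphi_n$ is $K$-Lipschitz; (4) $\varphi_m\circ\varphi_n=\varphi_{\min(m,n)}$ for all $m,n\in\mathbb{N}$. (A retraction is a map that restricts to the identity on its image.) $M$ has a retractional basis if it has a $K$-retractional basis for some $K\ge1$. *)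

theory Defs
  imports "HOL-Analysis.Analysis"
begin

definition fin_dim_subspace :: "'a::real_vector set \<Rightarrow> bool" where
  "fin_dim_subspace F \<longleftrightarrow> (\<exists>B. finite B \<and> span B = F)"

(* \<ell>_\<infinity>^n, realised inside the Banach space \<ell>_\<infinity> of bounded
   (automatically continuous) real sequences with the supremum norm, as the sequences
   supported on {0, ..., n - 1}. *)
definition linf :: "nat \<Rightarrow> (nat \<Rightarrow>\<^sub>C real) set" where
  "linf n = {f. \<forall>i\<ge>n. apply_bcontfun f i = 0}"

(* There is a linear bijection T from G onto H with norm(T) * norm(T^{-1}) \<le> lam; a and b
   are bounds for the operator norms of T on G and of T^{-1} on H. *)
definition isomorphic_const ::
  "real \<Rightarrow> 'a::real_normed_vector set \<Rightarrow> 'b::real_normed_vector set \<Rightarrow> bool" where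
  "isomorphic_const lam G H \<longleftrightarrow>
     (\<exists>T a b.
        bij_betw T G H \<and>
        (\<forall>x\<in>G. \<forall>y\<in>G. T (x + y) = T x + T y) \<and>
        (\<forall>c. \<forall>x\<in>G. T (c *\<^sub>R x) = c *\<^sub>R T x) \<and>
        0 \<le> a \<and> 0 \<le> b \<and> a * b \<le> lam \<and>
        (\<forall>x\<in>G. norm (T x) \<le> a * norm x) \<and>
        (\<forall>y\<in>H. norm (inv_into G T y) \<le> b * norm y))"

definition L_infinity_const_space :: "real \<Rightarrow> 'a::banach itself \<Rightarrow> bool" where
  "L_infinity_const_space lam (_ :: 'a itself) \<longleftrightarrow>
     (\<forall>F :: 'a set. fin_dim_subspace F \<longrightarrow>
        (\<exists>G. fin_dim_subspace G \<and> F \<subseteq> G \<and> isomorphic_const lam G (linf (dim G))))"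

definition L_infinity_space :: "'a::banach itself \<Rightarrow> bool" where
  "L_infinity_space X \<longleftrightarrow> (\<exists>lam\<ge>1. L_infinity_const_space lam X)"

definition net_in :: "'a::metric_space set \<Rightarrow> 'a set \<Rightarrow> bool" where
  "net_in Y N \<longleftrightarrow> N \<subseteq> Y \<and>
     (\<exists>a>0. \<exists>b>0.
        (\<forall>x\<in>N. \<forall>y\<in>N. x \<noteq> y \<longrightarrow> dist x y \<ge> a) \<and>
        (\<forall>x\<in>Y. \<exists>y\<in>N. dist x y \<le> b))"

(* Indices run over n \<ge> 1; the values phi 0 and x 0 play no role. The phi n are only
   considered on M. Countability of M is forced by x ` {1..} = M. *)
definition K_retractional_basis ::
  "real \<Rightarrow> 'a::metric_space set \<Rightarrow> (nat \<Rightarrow> 'a \<Rightarrow> 'a) \<Rightarrow> bool" where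
  "K_retractional_basis K M phi \<longleftrightarrow>
     (\<forall>n\<ge>1. phi n ` M \<subseteq> M \<and> (\<forall>y \<in> phi n ` M. phi n y = y)) \<and>
     (\<exists>x :: nat \<Rightarrow> 'a.
        (\<forall>n\<ge>1. phi n ` M = x ` {1..n}) \<and>
        x ` {1..} = M \<and>
        (\<forall>n\<ge>1. K-lipschitz_on M (phi n)) \<and>
        (\<forall>m\<ge>1. \<forall>n\<ge>1. \<forall>y\<in>M. phi m (phi n y) = phi (min m n) y))"

definition has_retractional_basis :: "'a::metric_space set \<Rightarrow> bool" where
  "has_retractional_basis M \<longleftrightarrow> (\<exists>K\<ge>1. \<exists>phi. K_retractional_basis K M phi)"

end

theory Submission
  imports Defs "HOL-Library.Discrete_Functions"
begin

text \<open>
  Distinct points of a net are a positive distance apart, so a map between nets is Lipschitz as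
  soon as it is Lipschitz up to an additive constant. Hence only the coarse geometry of the space
  counts, and bounded errors are harmless everywhere. The proof uses this freedom three times: to
  pass from continuous retractions to discrete ones, to refine big steps into steps that add one
  point at a time, and to replace the given net by a more convenient countable set.

  Algebraically, a retractional basis is a rooted tree: enumerate the points, give each point but
  the first a parent with a smaller index, and let the \<open>m\<close>-th retraction send a point to its first
  ancestor with index at most \<open>m\<close>. These maps commute for any choice of parents
  (\<open>ancestor_ancestor\<close>), so only the Lipschitz estimate has to be arranged
  (\<open>retractional_basis_from_tree\<close>).

  The linear input is a chain of commuting, uniformly bounded finite-rank projections \<open>P n\<close> whose
  ranges have dense union (\<open>L_infinity_projection_chain\<close>). Given \<open>P\<close>, one needs a projection \<open>Q\<close>
  onto a larger space with \<open>P \<circ> Q = P\<close>, whose norm does not depend on that of \<open>P\<close>. If \<open>R\<close> has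
  finite rank and \<open>P \<circ> R = P\<close>, and \<open>S\<close> is a projection onto a space containing the ranges of \<open>R\<close>
  and \<open>P\<close>, then \<open>Q = S + R \<circ> (I - S)\<close> will do. Bounded projections \<open>S\<close> exist because \<open>\<ell>\<^sub>\<infinity>\<^sup>n\<close> is
  injective, by Hahn and Banach applied to the coordinates. An operator \<open>R\<close> of norm at most \<open>lam\<close>
  with \<open>P \<circ> R\<close> close to \<open>P\<close> comes from a conditional expectation (\<open>averaging_along_directions\<close>):
  on a subspace like \<open>\<ell>\<^sub>\<infinity>\<^sup>n\<close>, average together the coordinates whose unit vectors are sent by \<open>P\<close>
  in almost the same direction. The number of groups depends on \<open>P\<close> only, not on the subspace, and
  therefore compactness glues the local averages to an operator on the whole space
  (\<open>L_infinity_almost_dual_identity\<close>).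

  The nonlinear step turns the projections into commuting, uniformly Lipschitz retractions
  \<open>retr n\<close> onto bounded subsets of the ranges, in which consecutive maps stay at bounded distance
  from each other. Composing radial retractions of one ball after the other with the projections
  would look dangerous for the Lipschitz constants, but all the scaling factors combine into a
  single one, given by the seminorm \<open>gauge k y = (SUP i. norm (P i y) / max (k + 1) i)\<close>. Between
  two consecutive ranges one lets the radius of the new component grow slowly.

  Finally one chooses finite nets of the ranges of the \<open>retr n\<close>, with errors summable in \<open>n\<close>, as
  levels of a tree (\<open>discretize_retractions\<close>). In infinite dimensions a large ball contains
  infinitely many points of any net, and also infinitely many vertices of the tree, so the
  vertices can be matched bijectively with the points of \<open>N\<close> at bounded distance.
\<close>

section \<open>Linear maps on subspaces and dominated extension\<close>

definition lin_on :: "'a::real_vector set \<Rightarrow> ('a \<Rightarrow> 'b::real_vector) \<Rightarrow> bool" where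
  "lin_on G f \<longleftrightarrow> (\<forall>x\<in>G. \<forall>y\<in>G. f (x + y) = f x + f y) \<and> (\<forall>c. \<forall>x\<in>G. f (c *\<^sub>R x) = c *\<^sub>R f x)"

lemma lin_on_subset: "lin_on H f \<Longrightarrow> G \<subseteq> H \<Longrightarrow> lin_on G f"
  unfolding lin_on_def by blast

lemma lin_on_cong: "lin_on G f \<Longrightarrow> subspace G \<Longrightarrow> (\<And>x. x \<in> G \<Longrightarrow> h x = f x) \<Longrightarrow> lin_on G h"
  unfolding lin_on_def by (simp add: subspace_add subspace_scale)

lemma lin_on_sum:
  assumes f: "lin_on G f" and G: "subspace G" and v: "\<And>i. i \<in> I \<Longrightarrow> v i \<in> G"
  shows "f (\<Sum>i\<in>I. c i *\<^sub>R v i) = (\<Sum>i\<in>I. c i *\<^sub>R f (v i))"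
proof (cases "finite I")
  case True
  then show ?thesis using v
  proof (induction I)
    case empty
    have "f (0 *\<^sub>R 0) = 0 *\<^sub>R f 0" using f G unfolding lin_on_def by (meson subspace_0)
    then show ?case by simp
  next
    case (insert i I)
    have "(\<Sum>i\<in>I. c i *\<^sub>R v i) \<in> G" "c i *\<^sub>R v i \<in> G" "v i \<in> G"
      using insert G by (auto intro!: subspace_sum subspace_scale)
    with insert f show ?case unfolding lin_on_def by simp
  qed
next
  case False
  have "f (0 *\<^sub>R 0) = 0 *\<^sub>R f 0" using f G unfolding lin_on_def by (meson subspace_0)
  then show ?thesis using False by simp
qed

lemma closed_Collect_Ball: "(\<And>x. x \<in> G \<Longrightarrow> closed {h. Q x h}) \<Longrightarrow> closed {h. \<forall>x\<in>G. Q x h}"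
  by (simp add: Collect_ball_eq closed_INT)

lemma closed_lin_on: "closed {h :: 'a::real_vector \<Rightarrow> real. lin_on G h}"
  unfolding lin_on_def real_scaleR_def
  by (intro closed_Collect_conj closed_Collect_Ball closed_Collect_all closed_Collect_eq
      continuous_intros continuous_on_product_coordinates)

text \<open>
  Tychonoff's theorem as a tool for gluing local solutions: a function with prescribed bounds that
  satisfies each of a directed family of closed conditions exists once every single condition can
  be met.
\<close>

lemma compact_choice:
  fixes b :: "'i \<Rightarrow> real" and C :: "'x set \<Rightarrow> ('i \<Rightarrow> real) set"
  assumes closed: "\<And>A. finite A \<Longrightarrow> closed (C A)"
    and antimono: "\<And>A B. finite B \<Longrightarrow> A \<subseteq> B \<Longrightarrow> C B \<subseteq> C A"
    and ne: "\<And>A. finite A \<Longrightarrow> \<exists>h\<in>C A. \<forall>i. \<bar>h i\<bar> \<le> b i"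
  shows "\<exists>h. (\<forall>i. \<bar>h i\<bar> \<le> b i) \<and> (\<forall>A. finite A \<longrightarrow> h \<in> C A)"
proof -
  define K where "K = (\<Pi>\<^sub>E i\<in>UNIV. cball (0::real) (b i))"
  have K: "h \<in> K \<longleftrightarrow> (\<forall>i. \<bar>h i\<bar> \<le> b i)" for h
    unfolding K_def by (auto simp: PiE_iff)
  have "compactin (product_topology (\<lambda>i. euclidean) UNIV) K"
    unfolding K_def by (simp add: compactin_PiE)
  then have "compact K" by (simp add: euclidean_product_topology)
  then have "K \<inter> (\<Inter>A\<in>{A. finite A}. C A) \<noteq> {}"
  proof (rule compact_imp_fip_image)
    show "closed (C A)" if "A \<in> {A. finite A}" for A using that closed by simp
    show "K \<inter> (\<Inter>A\<in>I. C A) \<noteq> {}" if I: "finite I" "I \<subseteq> {A. finite A}" for I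
    proof -
      have fin: "finite (\<Union>I)" using I by auto
      from ne[OF fin] obtain h where h: "h \<in> C (\<Union>I)" "\<forall>i. \<bar>h i\<bar> \<le> b i" by blast
      have "h \<in> C A" if "A \<in> I" for A using antimono[OF fin, of A] that h(1) by blast
      with h K show ?thesis by blast
    qed
  qed
  with K show ?thesis by blast
qed

text \<open>
  The value \<open>\<alpha>\<close> at the new vector has to satisfy \<open>\<bar>f y - \<alpha>\<bar> \<le> c * norm (y - a)\<close> for all \<open>y\<close> in
  \<open>G\<close>. Such an \<open>\<alpha>\<close> exists since \<open>f y - f z \<le> c * norm (y - a) + c * norm (z - a)\<close>.
\<close>

lemma extend_dominated_one_step:
  fixes f :: "'a::real_normed_vector \<Rightarrow> real"
  assumes G: "subspace G" and f: "lin_on G f" and dom: "\<And>x. x \<in> G \<Longrightarrow> \<bar>f x\<bar> \<le> c * norm x" and c: "0 \<le> c"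
  shows "\<exists>h. lin_on (span (insert a G)) h \<and> (\<forall>x\<in>span (insert a G). \<bar>h x\<bar> \<le> c * norm x) \<and> (\<forall>x\<in>G. h x = f x)"
proof (cases "a \<in> G")
  case True
  then have "span (insert a G) = G" using G by (simp add: insert_absorb span_eq_iff)
  with f dom show ?thesis by auto
next
  case a: False
  have fdiff: "f y - f z = f (y - z)" "y - z \<in> G" if "y \<in> G" "z \<in> G" for y z
  proof -
    show "y - z \<in> G" using that G by (simp add: subspace_diff)
    then have "f ((y - z) + z) = f (y - z) + f z" using f that unfolding lin_on_def by blast
    then show "f y - f z = f (y - z)" by simp
  qed
  have cross: "f y - c * norm (y - a) \<le> f z + c * norm (z - a)" if "y \<in> G" "z \<in> G" for y z
  proof -
    have "f y - f z \<le> c * norm (y - z)" using dom[of "y - z"] fdiff[OF that] by simp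
    also have "\<dots> \<le> c * (norm (y - a) + norm (z - a))"
      by (intro mult_left_mono c) (metis norm_minus_commute norm_triangle_sub add.commute norm_diff_triangle_ineq diff_add_cancel dist_norm dist_triangle2)
    finally show ?thesis by (simp add: algebra_simps)
  qed
  define \<alpha> where "\<alpha> = (SUP y\<in>G. f y - c * norm (y - a))"
  have G0: "0 \<in> G" using G by (rule subspace_0)
  have "bdd_above ((\<lambda>y. f y - c * norm (y - a)) ` G)"
    using cross[OF _ G0] by (auto intro!: bdd_aboveI)
  then have lo: "f y - c * norm (y - a) \<le> \<alpha>" if "y \<in> G" for y
    unfolding \<alpha>_def using that by (intro cSUP_upper)
  have hi: "\<alpha> \<le> f z + c * norm (z - a)" if "z \<in> G" for z
    unfolding \<alpha>_def using G0 cross that by (intro cSUP_least) auto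
  have \<alpha>: "\<bar>f y - \<alpha>\<bar> \<le> c * norm (y - a)" if "y \<in> G" for y
    using lo[OF that] hi[OF that] by simp
  have uniq: "k = l" if "x - k *\<^sub>R a \<in> G" "x - l *\<^sub>R a \<in> G" for x k l
  proof (rule ccontr)
    assume "k \<noteq> l"
    have "(x - l *\<^sub>R a) - (x - k *\<^sub>R a) \<in> G"
      using subspace_diff[OF G that(2) that(1)] .
    also have "(x - l *\<^sub>R a) - (x - k *\<^sub>R a) = (k - l) *\<^sub>R a" by (simp add: algebra_simps)
    finally have "(k - l) *\<^sub>R a \<in> G" .
    then have "(1 / (k - l)) *\<^sub>R (k - l) *\<^sub>R a \<in> G" by (rule subspace_scale[OF G])
    moreover have "(1 / (k - l)) *\<^sub>R (k - l) *\<^sub>R a = a" using \<open>k \<noteq> l\<close> by simp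
    ultimately show False using a by metis
  qed
  define k where "k x = (THE k. x - k *\<^sub>R a \<in> G)" for x
  have keq: "k x = l" if "x - l *\<^sub>R a \<in> G" for x l
    unfolding k_def by (rule the_equality) (fact that, rule uniq[OF _ that])
  have kG: "x - k x *\<^sub>R a \<in> G" if "x \<in> span (insert a G)" for x
  proof -
    have "span G = G" using G by (simp add: span_eq_iff)
    with that obtain l where "x - l *\<^sub>R a \<in> G"
      unfolding span_breakdown_eq by metis
    then show ?thesis by (simp only: keq)
  qed
  define h where "h x = f (x - k x *\<^sub>R a) + k x * \<alpha>" for x
  have add: "h (x + y) = h x + h y" if "x \<in> span (insert a G)" "y \<in> span (insert a G)" for x y
  proof -
    have e: "x + y - (k x + k y) *\<^sub>R a = (x - k x *\<^sub>R a) + (y - k y *\<^sub>R a)"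
      by (simp add: algebra_simps)
    then have "k (x + y) = k x + k y"
      by (intro keq) (simp only: e subspace_add[OF G kG[OF that(1)] kG[OF that(2)]])
    moreover have "f ((x - k x *\<^sub>R a) + (y - k y *\<^sub>R a)) = f (x - k x *\<^sub>R a) + f (y - k y *\<^sub>R a)"
      using kG[OF that(1)] kG[OF that(2)] f unfolding lin_on_def by blast
    ultimately show ?thesis unfolding h_def by (simp only: e distrib_right add_ac)
  qed
  have scale: "h (r *\<^sub>R x) = r *\<^sub>R h x" if "x \<in> span (insert a G)" for x r
  proof -
    have e: "r *\<^sub>R x - (r * k x) *\<^sub>R a = r *\<^sub>R (x - k x *\<^sub>R a)"
      by (simp add: algebra_simps)
    then have "k (r *\<^sub>R x) = r * k x"
      by (intro keq) (simp only: e subspace_scale[OF G kG[OF that(1)]])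
    moreover have "f (r *\<^sub>R (x - k x *\<^sub>R a)) = r *\<^sub>R f (x - k x *\<^sub>R a)"
      using kG[OF that(1)] f unfolding lin_on_def by blast
    ultimately show ?thesis unfolding h_def by (simp only: e real_scaleR_def distrib_left mult.assoc)
  qed
  have bound: "\<bar>h x\<bar> \<le> c * norm x" if x: "x \<in> span (insert a G)" for x
  proof (cases "k x = 0")
    case True
    with kG[OF x] dom[of x] show ?thesis by (simp add: h_def)
  next
    case False
    define y where "y = (- 1 / k x) *\<^sub>R (x - k x *\<^sub>R a)"
    have y: "y \<in> G" unfolding y_def by (rule subspace_scale[OF G kG[OF x]])
    have "f (x - k x *\<^sub>R a) = f ((- k x) *\<^sub>R y)" unfolding y_def using False by simp
    also have "\<dots> = - k x * f y" using f y unfolding lin_on_def real_scaleR_def by blast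
    finally have "\<bar>h x\<bar> = \<bar>k x\<bar> * \<bar>f y - \<alpha>\<bar>"
      unfolding h_def by (simp add: abs_mult[symmetric] algebra_simps abs_minus_commute)
    also have "\<dots> \<le> \<bar>k x\<bar> * (c * norm (y - a))" using \<alpha>[OF y] by (intro mult_left_mono) auto
    also have "\<dots> = c * norm (k x *\<^sub>R (y - a))" by simp
    also have "k x *\<^sub>R (y - a) = - x" unfolding y_def using False by (simp add: algebra_simps)
    finally show ?thesis by simp
  qed
  have ext: "h x = f x" if "x \<in> G" for x
    using keq[of x 0] that by (simp add: h_def)
  have "lin_on (span (insert a G)) h" unfolding lin_on_def using add scale by simp
  then show ?thesis by (intro exI[of _ h] conjI ballI) (assumption, erule bound, erule ext)
qed

lemma extend_dominated_finite:
  fixes f :: "'a::real_normed_vector \<Rightarrow> real"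
  assumes G: "subspace G" and f: "lin_on G f" and dom: "\<And>x. x \<in> G \<Longrightarrow> \<bar>f x\<bar> \<le> c * norm x" and c: "0 \<le> c"
    and "finite A"
  shows "\<exists>h. lin_on (span (A \<union> G)) h \<and> (\<forall>x\<in>span (A \<union> G). \<bar>h x\<bar> \<le> c * norm x) \<and> (\<forall>x\<in>G. h x = f x)"
  using \<open>finite A\<close>
proof induction
  case empty
  have e: "span ({} \<union> G) = G" using G by (simp add: span_eq_iff)
  show ?case unfolding e using f dom by blast
next
  case (insert a A)
  then obtain h where h: "lin_on (span (A \<union> G)) h" "\<forall>x\<in>span (A \<union> G). \<bar>h x\<bar> \<le> c * norm x" "\<forall>x\<in>G. h x = f x"
    by blast
  have e: "span (insert a (span (A \<union> G))) = span (insert a A \<union> G)"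
  proof (rule subset_antisym)
    show "span (insert a (span (A \<union> G))) \<subseteq> span (insert a A \<union> G)"
      by (rule span_minimal) (use span_mono[of "A \<union> G" "insert a A \<union> G"] in \<open>auto intro: span_base\<close>)
    show "span (insert a A \<union> G) \<subseteq> span (insert a (span (A \<union> G)))"
      by (rule span_mono) (auto intro: span_base)
  qed
  from h(2) have hb: "\<bar>h x\<bar> \<le> c * norm x" if "x \<in> span (A \<union> G)" for x using that by blast
  from extend_dominated_one_step[OF subspace_span h(1) hb c, of a, unfolded e] obtain g where g: "lin_on (span (insert a A \<union> G)) g"
    "\<forall>x\<in>span (insert a A \<union> G). \<bar>g x\<bar> \<le> c * norm x" "\<forall>x\<in>span (A \<union> G). g x = h x"
    by blast
  have "\<forall>x\<in>G. g x = f x" using g(3) h(3) by (simp add: span_base)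
  with g(1,2) show ?case by (intro exI[of _ g]) simp
qed

text \<open>
  Extensions to finitely many new vectors are glued by compactness, which replaces the usual
  maximality argument on partial extensions.
\<close>

lemma Hahn_Banach_dominated:
  fixes f :: "'a::real_normed_vector \<Rightarrow> real"
  assumes G: "subspace G" and f: "lin_on G f" and dom: "\<And>x. x \<in> G \<Longrightarrow> \<bar>f x\<bar> \<le> c * norm x" and c: "0 \<le> c"
  shows "\<exists>h. linear h \<and> (\<forall>x. \<bar>h x\<bar> \<le> c * norm x) \<and> (\<forall>x\<in>G. h x = f x)"
proof -
  define C where "C A = {h. lin_on (span (A \<union> G)) h} \<inter> {h. \<forall>x\<in>G. h x = f x}" for A
  have "\<exists>h. (\<forall>x. \<bar>h x\<bar> \<le> c * norm x) \<and> (\<forall>A. finite A \<longrightarrow> h \<in> C A)"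
  proof (rule compact_choice)
    show "closed (C A)" for A unfolding C_def
      by (intro closed_Int closed_lin_on closed_Collect_Ball closed_Collect_eq
          continuous_intros continuous_on_product_coordinates)
    show "C B \<subseteq> C A" if "A \<subseteq> B" for A B
    proof -
      have "span (A \<union> G) \<subseteq> span (B \<union> G)" using that by (intro span_mono) auto
      then show ?thesis unfolding C_def using lin_on_subset by blast
    qed
    fix A :: "'a set" assume "finite A"
    then obtain h where h: "lin_on (span (A \<union> G)) h" "\<forall>x\<in>span (A \<union> G). \<bar>h x\<bar> \<le> c * norm x" "\<forall>x\<in>G. h x = f x"
      using extend_dominated_finite[OF G f dom c] by blast
    \<comment> \<open>Off the span any bounded value is allowed; linearity is only required on the span.\<close>
    let ?h = "\<lambda>x. if x \<in> span (A \<union> G) then h x else 0"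
    have "?h \<in> C A" unfolding C_def using h(3) lin_on_cong[OF h(1) subspace_span, of ?h]
      by (simp add: span_base)
    moreover have "\<bar>?h x\<bar> \<le> c * norm x" for x using h(2) c by simp
    ultimately show "\<exists>h\<in>C A. \<forall>x. \<bar>h x\<bar> \<le> c * norm x" by (intro bexI[of _ ?h] allI)
  qed
  then obtain h where h: "\<forall>x. \<bar>h x\<bar> \<le> c * norm x" and C: "\<And>A. finite A \<Longrightarrow> h \<in> C A" by blast
  have "linear h"
  proof (rule linearI)
    fix x y r
    have "lin_on (span ({x, y} \<union> G)) h" using C[of "{x, y}"] unfolding C_def by simp
    moreover have "x \<in> span ({x, y} \<union> G)" "y \<in> span ({x, y} \<union> G)" by (auto intro: span_base)
    ultimately show "h (x + y) = h x + h y" "h (r *\<^sub>R x) = r *\<^sub>R h x" unfolding lin_on_def by simp_all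
  qed
  moreover have "\<forall>x\<in>G. h x = f x" using C[of "{}"] unfolding C_def by simp
  ultimately show ?thesis using h by blast
qed

section \<open>Finite-dimensional subspaces close to \<open>\<ell>\<^sub>\<infinity>\<^sup>n\<close>\<close>

text \<open>
  The identity of \<open>G\<close> factors as \<open>G \<rightarrow> \<ell>\<^sub>\<infinity>\<^sup>n \<rightarrow> G\<close>, where the first map has norm at most 1 and
  coordinates \<open>g i\<close>, and the second one has norm at most \<open>lam\<close> and sends the unit vectors to
  \<open>e i\<close>. Putting the whole distortion into the second map fixes the scaling of the isomorphism.
\<close>

definition linf_factor :: "real \<Rightarrow> 'a::real_normed_vector set \<Rightarrow> nat \<Rightarrow> (nat \<Rightarrow> 'a) \<Rightarrow> (nat \<Rightarrow> 'a \<Rightarrow> real) \<Rightarrow> bool" where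
  "linf_factor lam G n e g \<longleftrightarrow> subspace G \<and>
    (\<forall>i<n. e i \<in> G \<and> lin_on G (g i) \<and> (\<forall>x\<in>G. \<bar>g i x\<bar> \<le> norm x)) \<and>
    (\<forall>x\<in>G. x = (\<Sum>i<n. g i x *\<^sub>R e i)) \<and>
    (\<forall>c M. 0 \<le> M \<longrightarrow> (\<forall>i<n. \<bar>c i\<bar> \<le> M) \<longrightarrow> norm (\<Sum>i<n. c i *\<^sub>R e i) \<le> lam * M)"

lemma linf_factorization:
  fixes G :: "'a::real_normed_vector set"
  assumes iso: "isomorphic_const lam G (linf n)" and G: "subspace G"
  shows "\<exists>e g. linf_factor lam G n e g"
proof -
  from iso obtain T a b where bij: "bij_betw T G (linf n)" and lin: "lin_on G T"
    and ab: "0 \<le> a" "0 \<le> b" "a * b \<le> lam" and Ta: "\<And>x. x \<in> G \<Longrightarrow> norm (T x) \<le> a * norm x"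
    and Sb: "\<And>y. y \<in> linf n \<Longrightarrow> norm (inv_into G T y) \<le> b * norm y"
    unfolding isomorphic_const_def lin_on_def by blast
  have lam: "0 \<le> lam" using ab by (meson mult_nonneg_nonneg order_trans)
  have inj: "inj_on T G" using bij by (rule bij_betw_imp_inj_on)
  define S where "S = inv_into G T"
  have SG: "S y \<in> G" and TS: "T (S y) = y" if "y \<in> linf n" for y
    using that bij unfolding S_def bij_betw_def by (auto intro: inv_into_into f_inv_into_f)
  have T0: "T 0 = 0" using lin_on_sum[OF lin G, of "{}"] by simp
  show ?thesis
  proof (cases "a = 0")
    \<comment> \<open>A vanishing norm bound forces \<open>G\<close> to be trivial, and then rescaling by \<open>a\<close> is not possible.\<close>
    case True
    have G0: "x = 0" if "x \<in> G" for x
    proof -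
      have "T x = T 0" using Ta[OF that] True T0 by simp
      with inj that subspace_0[OF G] show ?thesis by (meson inj_onD)
    qed
    show ?thesis
      by (rule exI[of _ "\<lambda>_. 0"], rule exI[of _ "\<lambda>_ _. 0"])
        (use G0 lam G subspace_0[OF G] in \<open>auto simp: lin_on_def linf_factor_def\<close>)
  next
    case False
    with ab have a: "0 < a" by simp
    define \<delta> :: "nat \<Rightarrow> (nat \<Rightarrow>\<^sub>C real)" where "\<delta> i = Bcontfun (\<lambda>j. if j = i then 1 else 0)" for i
    have \<delta>: "apply_bcontfun (\<delta> i) j = (if j = i then 1 else 0)" for i j
    proof -
      have "(\<lambda>j. if j = i then 1 else (0::real)) \<in> bcontfun"
        by (rule bcontfun_normI[of _ 1]) auto
      then show ?thesis unfolding \<delta>_def by (simp add: Bcontfun_inverse)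
    qed
    have \<delta>l: "\<delta> i \<in> linf n" if "i < n" for i using that by (auto simp: linf_def \<delta>)
    have sum\<delta>: "apply_bcontfun (\<Sum>i<n. c i *\<^sub>R \<delta> i) j = (if j < n then c j else 0)" for c j
    proof -
      have "apply_bcontfun (\<Sum>i\<in>I. c i *\<^sub>R \<delta> i) j = (\<Sum>i\<in>I. c i * apply_bcontfun (\<delta> i) j)" for I
        by (induction I rule: infinite_finite_induct) simp_all
      then show ?thesis by (simp add: \<delta> if_distrib cong: if_cong)
    qed
    have vec: "(\<Sum>i<n. c i *\<^sub>R \<delta> i) \<in> linf n" for c unfolding linf_def by (simp add: sum\<delta>)
    have Tsum: "T (\<Sum>i<n. c i *\<^sub>R S (\<delta> i)) = (\<Sum>i<n. c i *\<^sub>R \<delta> i)" for c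
      by (subst lin_on_sum[OF lin G]) (auto simp: SG TS \<delta>l)
    have sumG: "(\<Sum>i<n. c i *\<^sub>R S (\<delta> i)) \<in> G" for c
      using G by (intro subspace_sum subspace_scale) (auto simp: SG \<delta>l)
    define e where "e i = a *\<^sub>R S (\<delta> i)" for i
    define g where "g i x = apply_bcontfun (T x) i / a" for i x
    have esum: "(\<Sum>i<n. c i *\<^sub>R e i) = a *\<^sub>R (\<Sum>i<n. c i *\<^sub>R S (\<delta> i))" for c
      unfolding e_def by (simp add: scaleR_sum_right mult.commute)
    have eG: "e i \<in> G" if "i < n" for i unfolding e_def using G by (intro subspace_scale) (auto simp: SG \<delta>l that)
    have glin: "lin_on G (g i)" for i
      using lin unfolding lin_on_def g_def by (simp add: add_divide_distrib)
    have gb: "\<bar>g i x\<bar> \<le> norm x" if "x \<in> G" for i x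
    proof -
      have "\<bar>apply_bcontfun (T x) i\<bar> \<le> norm x * a"
        using norm_bounded[of "T x" i] Ta[OF that] by (simp add: mult.commute)
      then show ?thesis unfolding g_def using a by (simp add: pos_divide_le_eq)
    qed
    have rep: "x = (\<Sum>i<n. g i x *\<^sub>R e i)" if "x \<in> G" for x
    proof -
      have Tx: "T x \<in> linf n" using that bij by (auto simp: bij_betw_def)
      have "T (\<Sum>i<n. apply_bcontfun (T x) i *\<^sub>R S (\<delta> i)) = T x"
        unfolding Tsum using Tx by (intro bcontfun_eqI) (auto simp: sum\<delta> linf_def)
      then have "(\<Sum>i<n. apply_bcontfun (T x) i *\<^sub>R S (\<delta> i)) = x"
        using inj sumG that by (meson inj_onD)
      then show ?thesis unfolding esum g_def using a by (simp add: scaleR_sum_right)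
    qed
    have bd: "norm (\<Sum>i<n. c i *\<^sub>R e i) \<le> lam * M" if M: "0 \<le> M" and c: "\<forall>i<n. \<bar>c i\<bar> \<le> M" for c M
    proof -
      have "(\<Sum>i<n. c i *\<^sub>R S (\<delta> i)) = S (\<Sum>i<n. c i *\<^sub>R \<delta> i)"
        unfolding Tsum[symmetric, of c] unfolding S_def
        by (rule inv_into_f_f[OF inj sumG[of c, unfolded S_def], symmetric])
      then have "norm (\<Sum>i<n. c i *\<^sub>R S (\<delta> i)) \<le> b * norm (\<Sum>i<n. c i *\<^sub>R \<delta> i)"
        using Sb[OF vec] unfolding S_def by simp
      also have "\<dots> \<le> b * M"
        using ab c M by (intro mult_left_mono norm_bound) (auto simp: sum\<delta>)
      finally have "norm (\<Sum>i<n. c i *\<^sub>R e i) \<le> a * (b * M)" unfolding esum using a by simp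
      also have "\<dots> \<le> lam * M" using ab M mult_right_mono[of "a * b" lam M] by (simp add: mult.assoc)
      finally show ?thesis .
    qed
    show ?thesis
      by (rule exI[of _ e], rule exI[of _ g], unfold linf_factor_def) (use G eG glin gb rep bd in blast)
  qed
qed

lemma L_infinity_factor:
  assumes "L_infinity_const_space lam TYPE('a::banach)" and "finite (A :: 'a set)"
  shows "\<exists>G n e g. A \<subseteq> G \<and> linf_factor lam G n e g"
proof -
  have "fin_dim_subspace (span A)" using assms(2) unfolding fin_dim_subspace_def by blast
  then obtain G where G: "fin_dim_subspace G" "span A \<subseteq> G" "isomorphic_const lam G (linf (dim G))"
    using assms(1) unfolding L_infinity_const_space_def by blast
  have sub: "subspace G" using G(1) unfolding fin_dim_subspace_def by auto
  have "A \<subseteq> G" using G(2) span_superset by blast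
  with linf_factorization[OF G(3) sub] show ?thesis by blast
qed

section \<open>Operators of finite rank\<close>

text \<open>
  Finite rank is generated by adding rank-one operators with bounded functionals, so that
  boundedness is built in and each of the properties below is an induction.
\<close>

inductive finite_rank :: "('a::real_normed_vector \<Rightarrow> 'b::real_normed_vector) \<Rightarrow> bool" where
  zero: "finite_rank (\<lambda>x. 0)"
| rank_one_add: "bounded_linear g \<Longrightarrow> finite_rank P \<Longrightarrow> finite_rank (\<lambda>x. g x *\<^sub>R e + P x)"

lemma finite_rank_bounded_linear: "finite_rank P \<Longrightarrow> bounded_linear P"
  by (induction rule: finite_rank.induct)
    (auto intro!: bounded_linear_add bounded_linear_scaleR_const)

lemma finite_rank_add: "finite_rank P \<Longrightarrow> finite_rank Q \<Longrightarrow> finite_rank (\<lambda>x. P x + Q x)"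
proof (induction rule: finite_rank.induct)
  case (rank_one_add g P e)
  then have "finite_rank (\<lambda>x. g x *\<^sub>R e + (P x + Q x))" by (intro finite_rank.rank_one_add) auto
  then show ?case by (simp add: add.assoc)
qed simp

lemma finite_rank_compose_right: "finite_rank P \<Longrightarrow> bounded_linear S \<Longrightarrow> finite_rank (\<lambda>x. P (S x))"
  by (induction rule: finite_rank.induct) (auto intro: finite_rank.intros bounded_linear_compose)

lemma finite_rank_compose_left:
  assumes "finite_rank P" and S: "linear S" shows "finite_rank (\<lambda>x. S (P x))"
  using assms(1)
proof (induction rule: finite_rank.induct)
  case zero
  then show ?case using S by (simp add: linear_0 finite_rank.zero)
next
  case (rank_one_add g P e)
  then have "finite_rank (\<lambda>x. g x *\<^sub>R S e + S (P x))" by (intro finite_rank.rank_one_add)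
  then show ?case using S by (simp add: linear_add linear_scale)
qed

lemma finite_rank_sum:
  assumes "finite I" "\<And>i. i \<in> I \<Longrightarrow> bounded_linear (g i)"
  shows "finite_rank (\<lambda>x. \<Sum>i\<in>I. g i x *\<^sub>R e i)"
  using assms by (induction I) (auto intro: finite_rank.intros)

lemma finite_rank_diff: "finite_rank P \<Longrightarrow> finite_rank Q \<Longrightarrow> finite_rank (\<lambda>x. P x - Q x)"
proof -
  assume P: "finite_rank P" and Q: "finite_rank Q"
  have "finite_rank (\<lambda>x. - Q x)"
    by (rule finite_rank_compose_left[OF Q, of uminus]) (simp add: linear_uminus)
  from finite_rank_add[OF P this] show ?thesis by simp
qed

lemma finite_rank_range: "finite_rank P \<Longrightarrow> \<exists>B. finite B \<and> range P \<subseteq> span B"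
proof (induction rule: finite_rank.induct)
  case zero
  then show ?case by (intro exI[of _ "{}"]) auto
next
  case (rank_one_add g P e)
  then obtain B where B: "finite B" "range P \<subseteq> span B" by blast
  have "g x *\<^sub>R e + P x \<in> span (insert e B)" for x
  proof (intro span_add span_scale)
    show "e \<in> span (insert e B)" by (simp add: span_base)
    have "span B \<subseteq> span (insert e B)" by (rule span_mono) auto
    with B(2) show "P x \<in> span (insert e B)" by blast
  qed
  with B(1) show ?case by (intro exI[of _ "insert e B"]) blast
qed

lemma finite_rank_compact: "finite_rank P \<Longrightarrow> \<exists>K. compact K \<and> P ` cball 0 r \<subseteq> K"
proof (induction rule: finite_rank.induct)
  case zero
  then show ?case by (intro exI[of _ "{0}"]) auto
next
  case (rank_one_add g P e)
  then obtain K where K: "compact K" "P ` cball 0 r \<subseteq> K" by blast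
  obtain c where c: "\<And>x. norm (g x) \<le> norm x * c" "0 \<le> c"
    using bounded_linear.nonneg_bounded[OF rank_one_add(1)] by blast
  let ?I = "(\<lambda>t. t *\<^sub>R e) ` {- (r * c)..r * c}"
  have "compact ?I" by (intro compact_continuous_image continuous_intros) simp
  then have "compact {s + t |s t. s \<in> ?I \<and> t \<in> K}" using K(1) by (rule compact_sums)
  have "g x *\<^sub>R e + P x \<in> {s + t |s t. s \<in> ?I \<and> t \<in> K}" if "x \<in> cball 0 r" for x
  proof -
    have "norm x * c \<le> r * c" using that c by (intro mult_right_mono) auto
    then have "g x \<in> {- (r * c)..r * c}" using c(1)[of x] by auto
    then have "g x *\<^sub>R e \<in> ?I" by blast
    moreover have "P x \<in> K" using that K by blast
    ultimately show ?thesis by blast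
  qed
  then have "(\<lambda>x. g x *\<^sub>R e + P x) ` cball 0 r \<subseteq> {s + t |s t. s \<in> ?I \<and> t \<in> K}"
    by (rule image_subsetI)
  with \<open>compact {s + t |s t. s \<in> ?I \<and> t \<in> K}\<close> show ?case
    by (intro exI[of _ "{s + t |s t. s \<in> ?I \<and> t \<in> K}"] conjI)
qed

text \<open>
  A finite-rank operator maps unconditionally bounded families to absolutely summable ones, with a
  constant \<open>\<kappa>\<close> that does not depend on the length of the family: for a single functional one
  chooses the signs of its values as coefficients.
\<close>

lemma finite_rank_sum_norm:
  assumes "finite_rank P"
  shows "\<exists>\<kappa>\<ge>0. \<forall>(n::nat) e B. (\<forall>c. (\<forall>i<n. \<bar>c i\<bar> \<le> 1) \<longrightarrow> norm (\<Sum>i<n. c i *\<^sub>R e i) \<le> B) \<longrightarrow> (\<Sum>i<n. norm (P (e i))) \<le> \<kappa> * B"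
  using assms
proof (induction rule: finite_rank.induct)
  case zero
  then show ?case by (intro exI[of _ 0]) auto
next
  case (rank_one_add g P v)
  then obtain \<kappa> where \<kappa>: "0 \<le> \<kappa>" "\<And>(n::nat) e B. (\<forall>c. (\<forall>i<n. \<bar>c i\<bar> \<le> 1) \<longrightarrow> norm (\<Sum>i<n. c i *\<^sub>R e i) \<le> B) \<Longrightarrow> (\<Sum>i<n. norm (P (e i))) \<le> \<kappa> * B"
    by blast
  interpret g: bounded_linear g by fact
  obtain k where k: "\<And>x. norm (g x) \<le> norm x * k" "0 \<le> k" using g.nonneg_bounded by blast
  have "(\<Sum>i<n. norm (g (e i) *\<^sub>R v + P (e i))) \<le> (k * norm v + \<kappa>) * B"
    if B: "\<forall>c. (\<forall>i<n. \<bar>c i\<bar> \<le> 1) \<longrightarrow> norm (\<Sum>i<n. c i *\<^sub>R e i) \<le> B" for n :: nat and e B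
  proof -
    have "(\<Sum>i<n. \<bar>g (e i)\<bar>) = (\<Sum>i<n. sgn (g (e i)) * g (e i))"
      by (intro sum.cong refl) (metis abs_sgn mult.commute)
    also have "\<dots> = g (\<Sum>i<n. sgn (g (e i)) *\<^sub>R e i)"
      by (simp add: g.sum g.scaleR)
    also have "\<dots> \<le> norm (\<Sum>i<n. sgn (g (e i)) *\<^sub>R e i) * k"
      using k(1)[of "\<Sum>i<n. sgn (g (e i)) *\<^sub>R e i"] by simp
    also have "\<dots> \<le> B * k" using B k(2) by (intro mult_right_mono) (auto simp: abs_sgn_eq)
    finally have "(\<Sum>i<n. \<bar>g (e i)\<bar>) * norm v \<le> B * k * norm v" by (intro mult_right_mono) auto
    then have "(\<Sum>i<n. \<bar>g (e i)\<bar> * norm v) \<le> B * k * norm v" by (simp only: sum_distrib_right)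
    moreover have "(\<Sum>i<n. norm (g (e i) *\<^sub>R v + P (e i))) \<le> (\<Sum>i<n. \<bar>g (e i)\<bar> * norm v + norm (P (e i)))"
      by (intro sum_mono order_trans[OF norm_triangle_ineq]) simp
    ultimately show ?thesis using \<kappa>(2)[OF B]
      by (simp add: sum.distrib distrib_left distrib_right mult_ac)
  qed
  moreover have "0 \<le> k * norm v + \<kappa>" using k \<kappa>(1) by simp
  ultimately show ?case by blast
qed

section \<open>Finite nets and separated sets\<close>

lemma compact_finite_net:
  fixes K :: "'a::metric_space set"
  assumes "compact K" "0 < e"
  shows "\<exists>Z. finite Z \<and> K \<subseteq> (\<Union>z\<in>Z. ball z e)"
proof -
  have "seq_compact K" using assms(1) by (simp add: compact_eq_seq_compact_metric)
  from seq_compact_imp_totally_bounded[OF this, rule_format, OF assms(2)] show ?thesis by blast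
qed

lemma finite_net_within:
  fixes S :: "'a::metric_space set"
  assumes K: "compact K" "S \<subseteq> K" and e: "0 < e"
  shows "\<exists>F. finite F \<and> F \<subseteq> S \<and> (\<forall>x\<in>S. \<exists>y\<in>F. dist x y < e)"
proof -
  obtain Z where Z: "finite Z" "K \<subseteq> (\<Union>z\<in>Z. ball z (e / 2))"
    using compact_finite_net[OF K(1), of "e / 2"] e by auto
  define f where "f z = (SOME x. x \<in> S \<and> dist z x < e / 2)" for z
  define F where "F = f ` {z \<in> Z. \<exists>x\<in>S. dist z x < e / 2}"
  have f: "f z \<in> S \<and> dist z (f z) < e / 2" if "\<exists>x\<in>S. dist z x < e / 2" for z
    unfolding f_def by (rule someI_ex) (use that in blast)
  have "\<exists>y\<in>F. dist x y < e" if x: "x \<in> S" for x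
  proof -
    have "x \<in> (\<Union>z\<in>Z. ball z (e / 2))" using x K(2) Z(2) by blast
    then obtain z where z: "z \<in> Z" "dist z x < e / 2" unfolding UN_iff mem_ball by blast
    then have "dist z (f z) < e / 2" using f x by blast
    then have "dist x (f z) < e" using z(2) dist_triangle_half_r by blast
    moreover have "f z \<in> F" unfolding F_def using z x by blast
    ultimately show ?thesis by blast
  qed
  moreover have "finite F" "F \<subseteq> S" unfolding F_def using Z(1) f by auto
  ultimately show ?thesis by blast
qed

lemma countable_separated:
  fixes N :: "'a::metric_space set"
  assumes sep: "separable_space (euclidean :: 'a topology)" and a: "0 < a"
    and N: "\<And>x y. x \<in> N \<Longrightarrow> y \<in> N \<Longrightarrow> x \<noteq> y \<Longrightarrow> a \<le> dist x y"
  shows "countable N"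
proof -
  obtain D :: "'a set" where D: "countable D" "closure D = UNIV"
    using sep unfolding separable_space_def by auto
  have "\<exists>d\<in>D. dist d x < a / 2" for x
  proof -
    have "x \<in> closure D" using D(2) by simp
    then have "\<forall>e>0. \<exists>d\<in>D. dist d x < e" by (simp only: closure_approachable)
    then show ?thesis using half_gt_zero[OF a] by blast
  qed
  then obtain d where d: "\<And>x. d x \<in> D" "\<And>x. dist (d x) x < a / 2" by metis
  have "inj_on d N"
  proof (rule inj_onI, rule ccontr)
    fix x y assume xy: "x \<in> N" "y \<in> N" "d x = d y" "x \<noteq> y"
    have "dist x y \<le> dist (d x) x + dist (d y) y" using xy(3) by (metis dist_commute dist_triangle)
    with d(2)[of x] d(2)[of y] N[OF xy(1,2,4)] show False by simp
  qed
  moreover have "countable (d ` N)" using d(1) D(1) by (meson countable_subset image_subsetI)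
  ultimately show ?thesis by (rule countable_image_inj_on[rotated])
qed

section \<open>Averaging along directions\<close>

text \<open>
  The coordinates of a subspace like \<open>\<ell>\<^sub>\<infinity>\<^sup>n\<close> extend to the whole space without increasing their
  norm, and this extends the identity of \<open>G\<close> to a projection onto \<open>G\<close>.
\<close>

lemma L_infinity_projection:
  assumes "L_infinity_const_space lam TYPE('a::banach)" and "finite (A :: 'a set)"
  shows "\<exists>P :: 'a \<Rightarrow> 'a. finite_rank P \<and> (\<forall>x. norm (P x) \<le> lam * norm x) \<and> (\<forall>x. P (P x) = P x) \<and> (\<forall>x\<in>span A. P x = x)"
proof -
  obtain G n e g where AG: "A \<subseteq> G" and "linf_factor lam G n e g"
    using L_infinity_factor[OF assms] by blast
  then have G: "subspace G" and g: "\<And>i. i < n \<Longrightarrow> lin_on G (g i)" "\<And>i x. i < n \<Longrightarrow> x \<in> G \<Longrightarrow> \<bar>g i x\<bar> \<le> norm x"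
    and eG: "\<And>i. i < n \<Longrightarrow> e i \<in> G" and rep: "\<And>x. x \<in> G \<Longrightarrow> x = (\<Sum>i<n. g i x *\<^sub>R e i)"
    and bd: "\<And>c M. 0 \<le> M \<Longrightarrow> (\<And>i. i < n \<Longrightarrow> \<bar>c i\<bar> \<le> M) \<Longrightarrow> norm (\<Sum>i<n. c i *\<^sub>R e i) \<le> lam * M"
    unfolding linf_factor_def by blast+
  have "\<forall>i\<in>{..<n}. \<exists>h. linear h \<and> (\<forall>x. \<bar>h x\<bar> \<le> 1 * norm x) \<and> (\<forall>x\<in>G. h x = g i x)"
    using g by (intro ballI Hahn_Banach_dominated[OF G]) auto
  from bchoice[OF this] obtain h where h: "\<And>i. i < n \<Longrightarrow> linear (h i)"
    "\<And>i x. i < n \<Longrightarrow> \<bar>h i x\<bar> \<le> norm x" "\<And>i x. i < n \<Longrightarrow> x \<in> G \<Longrightarrow> h i x = g i x"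
    by auto
  define P where "P x = (\<Sum>i<n. h i x *\<^sub>R e i)" for x
  have "bounded_linear (h i)" if "i < n" for i
    using h(1,2)[OF that] by (intro bounded_linear_intro[of _ 1]) (auto simp: linear_add linear_scale)
  then have fr: "finite_rank P" unfolding P_def by (intro finite_rank_sum) auto
  have Pb: "norm (P x) \<le> lam * norm x" for x unfolding P_def using h(2) by (intro bd) auto
  have PG: "P x \<in> G" for x
    unfolding P_def using G eG by (intro subspace_sum subspace_scale) auto
  have idG: "P x = x" if "x \<in> G" for x
  proof -
    have "P x = (\<Sum>i<n. g i x *\<^sub>R e i)" unfolding P_def using h(3) that by (intro sum.cong) auto
    with rep[OF that] show ?thesis by simp
  qed
  have "span A \<subseteq> G" using AG G by (rule span_minimal)
  then have "P x = x" if "x \<in> span A" for x using idG that by blast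
  moreover have "P (P x) = P x" for x by (rule idG[OF PG])
  ultimately show ?thesis using fr Pb by blast
qed


lemma direction_net:
  fixes P :: "'a::real_normed_vector \<Rightarrow> 'a"
  assumes P: "finite_rank P" and idem: "\<And>x. P (P x) = P x" and \<eta>: "0 < \<eta>"
  shows "\<exists>Z. finite Z \<and> (\<forall>x. \<exists>z\<in>Z. norm (P x - norm (P x) *\<^sub>R z) \<le> \<eta> * norm (P x))"
proof -
  obtain K where K: "compact K" "P ` cball 0 1 \<subseteq> K" using finite_rank_compact[OF P] by blast
  obtain Z where Z: "finite Z" "K \<subseteq> (\<Union>z\<in>Z. ball z \<eta>)"
    using compact_finite_net[OF K(1) \<eta>] by blast
  have lin: "linear P" using finite_rank_bounded_linear[OF P] by (rule bounded_linear.linear)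
  have "\<exists>z\<in>insert 0 Z. norm (P x - norm (P x) *\<^sub>R z) \<le> \<eta> * norm (P x)" for x
  proof (cases "P x = 0")
    case True
    then show ?thesis by (intro bexI[of _ 0]) auto
  next
    case False
    define w where "w = (1 / norm (P x)) *\<^sub>R P x"
    have "P w = w" unfolding w_def by (simp add: linear_scale[OF lin] idem)
    moreover have "w \<in> cball 0 1" unfolding w_def using False by simp
    ultimately have "w \<in> K" using K(2) by (metis image_subset_iff)
    then obtain z where z: "z \<in> Z" "norm (w - z) < \<eta>"
      using Z(2) by (auto simp: dist_norm norm_minus_commute)
    have "P x - norm (P x) *\<^sub>R z = norm (P x) *\<^sub>R (w - z)"
      unfolding w_def using False by (simp add: scaleR_diff_right)
    then have "norm (P x - norm (P x) *\<^sub>R z) = norm (P x) * norm (w - z)" by simp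
    also have "\<dots> \<le> norm (P x) * \<eta>" using z(2) by (intro mult_left_mono) auto
    finally show ?thesis using z(1) by (intro bexI[of _ z]) (auto simp: mult.commute)
  qed
  with Z(1) show ?thesis by (intro exI[of _ "insert 0 Z"]) auto
qed

text \<open>
  Let \<open>v i = P (e i)\<close>. The coordinates \<open>i\<close> are grouped by a direction \<open>z\<close> in \<open>Z\<close> with \<open>v i\<close> close
  to \<open>norm (v i) *\<^sub>R z\<close>, and \<open>h z\<close> is the average of the coordinates in group \<open>z\<close> with weights
  \<open>norm (v i)\<close>. If all \<open>v i\<close> in a group were exact multiples of \<open>z\<close>, replacing the coordinates by
  their weighted average would not change \<open>P x\<close>; so the error is controlled by \<open>\<eta>\<close> and the total
  weight. Both norm bounds survive, because \<open>h z\<close> is an average and because the groups are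
  disjoint. Only \<open>card Z\<close> vectors \<open>u z\<close> are left, no matter how large \<open>n\<close> is.
\<close>

lemma averaging_along_directions:
  fixes P :: "'a::real_normed_vector \<Rightarrow> 'a"
  assumes fac: "linf_factor lam G n e g" and lin: "linear P"
    and Z: "finite Z" "\<And>x. \<exists>z\<in>Z. norm (P x - norm (P x) *\<^sub>R z) \<le> \<eta> * norm (P x)"
    and S: "(\<Sum>i<n. norm (P (e i))) \<le> S" and \<eta>: "0 \<le> \<eta>"
  shows "\<exists>h u. (\<forall>z. lin_on G (h z) \<and> (\<forall>x\<in>G. \<bar>h z x\<bar> \<le> norm x)) \<and>
    (\<forall>a M. 0 \<le> M \<longrightarrow> (\<forall>z\<in>Z. \<bar>a z\<bar> \<le> M) \<longrightarrow> norm (\<Sum>z\<in>Z. a z *\<^sub>R u z) \<le> lam * M) \<and>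
    (\<forall>x\<in>G. norm (P x - (\<Sum>z\<in>Z. h z x *\<^sub>R P (u z))) \<le> 2 * \<eta> * S * norm x)"
proof -
  from fac have G: "subspace G" and g: "\<And>i. i < n \<Longrightarrow> lin_on G (g i)" "\<And>i x. i < n \<Longrightarrow> x \<in> G \<Longrightarrow> \<bar>g i x\<bar> \<le> norm x"
    and eG: "\<And>i. i < n \<Longrightarrow> e i \<in> G" and rep: "\<And>x. x \<in> G \<Longrightarrow> x = (\<Sum>i<n. g i x *\<^sub>R e i)"
    and bd: "\<And>c M. 0 \<le> M \<Longrightarrow> (\<And>i. i < n \<Longrightarrow> \<bar>c i\<bar> \<le> M) \<Longrightarrow> norm (\<Sum>i<n. c i *\<^sub>R e i) \<le> lam * M"
    unfolding linf_factor_def by blast+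
  define v where "v i = P (e i)" for i
  define w where "w i = norm (v i)" for i
  have w0: "0 \<le> w i" for i by (simp add: w_def)
  have "\<forall>i. \<exists>z. z \<in> Z \<and> norm (v i - w i *\<^sub>R z) \<le> \<eta> * w i" using Z(2) unfolding v_def w_def by blast
  then obtain d where d: "\<And>i. d i \<in> Z" "\<And>i. norm (v i - w i *\<^sub>R d i) \<le> \<eta> * w i" by metis
  define I where "I z = {i \<in> {..<n}. d i = z}" for z
  have finI: "finite (I z)" for z unfolding I_def by simp
  have group: "(\<Sum>z\<in>Z. \<Sum>i\<in>I z. f i) = (\<Sum>i<n. f i)" for f :: "nat \<Rightarrow> 'a"
    unfolding I_def using Z(1) d(1) by (intro sum.group) auto
  define m where "m z = (\<Sum>i\<in>I z. w i)" for z
  have m0: "0 \<le> m z" for z unfolding m_def by (intro sum_nonneg w0)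
  define h where "h z x = (\<Sum>i\<in>I z. w i * g i x) / m z" for z x
  define u where "u z = (\<Sum>i\<in>I z. e i)" for z
  have hlin: "lin_on G (h z)" for z
    unfolding lin_on_def
  proof (intro conjI allI ballI)
    fix x y c assume xy: "x \<in> G"
    have "(\<Sum>i\<in>I z. w i * g i (c *\<^sub>R x)) = (\<Sum>i\<in>I z. c * (w i * g i x))"
      using g(1) xy by (intro sum.cong) (auto simp: I_def lin_on_def)
    then show "h z (c *\<^sub>R x) = c *\<^sub>R h z x" unfolding h_def by (simp add: sum_distrib_left)
  next
    fix x y assume xy: "x \<in> G" "y \<in> G"
    have "(\<Sum>i\<in>I z. w i * g i (x + y)) = (\<Sum>i\<in>I z. w i * g i x + w i * g i y)"
      using g(1) xy by (intro sum.cong) (auto simp: I_def lin_on_def distrib_left)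
    then show "h z (x + y) = h z x + h z y" unfolding h_def by (simp add: sum.distrib add_divide_distrib)
  qed
  have hb: "\<bar>h z x\<bar> \<le> norm x" if x: "x \<in> G" for z x
  proof (cases "m z = 0")
    case True
    then show ?thesis by (simp add: h_def)
  next
    case False
    have "\<bar>\<Sum>i\<in>I z. w i * g i x\<bar> \<le> (\<Sum>i\<in>I z. w i * norm x)"
      using g(2)[OF _ x] w0 by (intro sum_abs[THEN order_trans] sum_mono) (auto simp: I_def abs_mult intro: mult_left_mono)
    also have "\<dots> = norm x * m z" by (simp add: m_def sum_distrib_left mult.commute)
    finally show ?thesis unfolding h_def using False m0[of z] by (simp add: pos_divide_le_eq)
  qed
  \<comment> \<open>By the choice of the weights the deviations from the average cancel; this also holds for groups of weight 0.\<close>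
  have bal: "(\<Sum>i\<in>I z. (g i x - h z x) * w i) = 0" for z x
  proof (cases "m z = 0")
    case True
    then have "\<forall>i\<in>I z. w i = 0" unfolding m_def using finI w0 by (simp add: sum_nonneg_eq_0_iff)
    then show ?thesis by simp
  next
    case False
    have "(\<Sum>i\<in>I z. (g i x - h z x) * w i) = (\<Sum>i\<in>I z. w i * g i x) - h z x * m z"
      unfolding m_def by (simp add: left_diff_distrib sum_subtractf sum_distrib_left mult.commute right_diff_distrib)
    then show ?thesis unfolding h_def using False by simp
  qed
  have expand: "(\<Sum>z\<in>Z. a z *\<^sub>R (\<Sum>i\<in>I z. y i)) = (\<Sum>i<n. a (d i) *\<^sub>R y i)" for a and y :: "nat \<Rightarrow> 'a"
  proof -
    have "(\<Sum>z\<in>Z. a z *\<^sub>R (\<Sum>i\<in>I z. y i)) = (\<Sum>z\<in>Z. \<Sum>i\<in>I z. a (d i) *\<^sub>R y i)"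
      unfolding scaleR_sum_right by (intro sum.cong refl) (auto simp: I_def)
    then show ?thesis by (simp only: group)
  qed
  have "norm (\<Sum>z\<in>Z. a z *\<^sub>R u z) \<le> lam * M" if "0 \<le> M" "\<forall>z\<in>Z. \<bar>a z\<bar> \<le> M" for a M
    unfolding u_def expand using that d(1) by (intro bd) auto
  moreover have "norm (P x - (\<Sum>z\<in>Z. h z x *\<^sub>R P (u z))) \<le> 2 * \<eta> * S * norm x" if x: "x \<in> G" for x
  proof -
    have "P x = P (\<Sum>i<n. g i x *\<^sub>R e i)" using rep[OF x] by simp
    then have Px: "P x = (\<Sum>i<n. g i x *\<^sub>R v i)"
      by (simp add: v_def linear_sum[OF lin] linear_scale[OF lin])
    have Pu: "P (u z) = (\<Sum>i\<in>I z. v i)" for z unfolding u_def v_def by (rule linear_sum[OF lin])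
    define t where "t i = g i x - h (d i) x" for i
    have "(\<Sum>i<n. (t i * w i) *\<^sub>R d i) = (\<Sum>z\<in>Z. \<Sum>i\<in>I z. (t i * w i) *\<^sub>R d i)" by (simp only: group)
    also have "\<dots> = (\<Sum>z\<in>Z. (\<Sum>i\<in>I z. (g i x - h z x) * w i) *\<^sub>R z)"
      unfolding scaleR_sum_left by (intro sum.cong refl) (auto simp: I_def t_def)
    finally have zero: "(\<Sum>i<n. (t i * w i) *\<^sub>R d i) = 0" by (simp add: bal)
    \<comment> \<open>Subtracting the zero sum replaces each \<open>v i\<close> by its small distance to a multiple of \<open>d i\<close>.\<close>
    have "P x - (\<Sum>z\<in>Z. h z x *\<^sub>R P (u z)) = (\<Sum>i<n. t i *\<^sub>R v i)"
      unfolding Px Pu expand t_def by (simp add: scaleR_diff_left sum_subtractf)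
    also have "\<dots> = (\<Sum>i<n. t i *\<^sub>R v i) - (\<Sum>i<n. (t i * w i) *\<^sub>R d i)" by (simp add: zero)
    also have "\<dots> = (\<Sum>i<n. t i *\<^sub>R (v i - w i *\<^sub>R d i))"
      by (simp add: scaleR_diff_right sum_subtractf)
    also have "norm \<dots> \<le> (\<Sum>i<n. (2 * norm x) * (\<eta> * w i))"
    proof (intro sum_norm_le)
      fix i assume "i \<in> {..<n}"
      then have "\<bar>t i\<bar> \<le> 2 * norm x" using g(2)[OF _ x, of i] hb[OF x, of "d i"] unfolding t_def by simp
      then show "norm (t i *\<^sub>R (v i - w i *\<^sub>R d i)) \<le> (2 * norm x) * (\<eta> * w i)"
        using d(2)[of i] by (simp only: norm_scaleR) (intro mult_mono, auto)
    qed
    also have "\<dots> = (2 * norm x * \<eta>) * (\<Sum>i<n. w i)" by (simp add: sum_distrib_left mult.assoc)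
    also have "\<dots> \<le> (2 * norm x * \<eta>) * S" using S \<eta> unfolding w_def v_def by (intro mult_left_mono) auto
    finally show ?thesis by (simp add: mult_ac)
  qed
  ultimately show ?thesis using hlin hb by (intro exI[of _ h] exI[of _ u]) simp
qed

text \<open>
  If each of finitely many candidates \<open>y\<close> failed at some finite set, all would fail at the union
  of these sets.
\<close>

lemma directed_pigeonhole:
  assumes fin: "finite Y" and ex: "\<And>A. finite A \<Longrightarrow> \<exists>y\<in>Y. Q A y"
    and anti: "\<And>A B y. A \<subseteq> B \<Longrightarrow> Q B y \<Longrightarrow> Q A y"
  shows "\<exists>y\<in>Y. \<forall>A. finite A \<longrightarrow> Q A y"
proof (rule ccontr)
  assume "\<not> ?thesis"
  then have "\<forall>y\<in>Y. \<exists>A. finite A \<and> \<not> Q A y" by blast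
  from bchoice[OF this] obtain A where A: "\<And>y. y \<in> Y \<Longrightarrow> finite (A y) \<and> \<not> Q (A y) y" by blast
  then have "finite (\<Union>y\<in>Y. A y)" using fin by blast
  from ex[OF this] obtain y where "y \<in> Y" "Q (\<Union>y\<in>Y. A y) y" by blast
  with anti[of "A y" "\<Union>y\<in>Y. A y" y] A show False by blast
qed

text \<open>
  Dually, the adjoint of \<open>R\<close> almost fixes the functionals that factor through \<open>P\<close>, with a bound on
  its norm that does not involve the norm of \<open>P\<close>. For each finite set \<open>A\<close>, averaging along
  directions gives functionals \<open>h z\<close> on the span of \<open>A\<close> and vectors \<open>u z\<close>. The functionals have a
  limit by compactness, the vectors in general have none. However, the estimate only involves
  their images \<open>P (u z)\<close>, which lie in a compact set. By the pigeonhole principle these images can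
  be rounded to vectors \<open>y z\<close> that are the same for all \<open>A\<close>, and the vectors \<open>u z\<close> of one fixed
  \<open>A\<close> serve for all.
\<close>

lemma L_infinity_almost_dual_identity:
  fixes P :: "'a::banach \<Rightarrow> 'a"
  assumes L: "L_infinity_const_space lam TYPE('a)" and lam: "0 \<le> lam"
    and P: "finite_rank P" and idem: "\<And>x. P (P x) = P x"
  shows "\<exists>R :: 'a \<Rightarrow> 'a. finite_rank R \<and> (\<forall>x. norm (R x) \<le> lam * norm x) \<and> (\<forall>x. norm (P x - P (R x)) \<le> norm x)"
proof -
  have lin: "linear P" using finite_rank_bounded_linear[OF P] by (rule bounded_linear.linear)
  obtain \<kappa> where \<kappa>: "0 \<le> \<kappa>" "\<And>(n::nat) e B. (\<forall>c. (\<forall>i<n. \<bar>c i\<bar> \<le> 1) \<longrightarrow> norm (\<Sum>i<n. c i *\<^sub>R e i) \<le> B) \<Longrightarrow> (\<Sum>i<n. norm (P (e i))) \<le> \<kappa> * B"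
    using finite_rank_sum_norm[OF P] by blast
  \<comment> \<open>Half of the admissible error goes to the averaging, a quarter to each of the two roundings
    between \<open>P (u z)\<close> and \<open>y z\<close>.\<close>
  define \<eta> where "\<eta> = 1 / (4 * (\<kappa> * lam + 1))"
  have \<kappa>l: "0 \<le> \<kappa> * lam" using \<kappa>(1) lam by simp
  then have \<eta>: "0 < \<eta>" "2 * \<eta> * (\<kappa> * lam) \<le> 1 / 2" unfolding \<eta>_def by (auto simp: divide_simps)
  obtain Z where Z: "finite Z" "\<And>x. \<exists>z\<in>Z. norm (P x - norm (P x) *\<^sub>R z) \<le> \<eta> * norm (P x)"
    using direction_net[OF P idem \<eta>(1)] by blast
  define \<delta> where "\<delta> = 1 / (4 * (real (card Z) + 1))"
  have \<delta>: "0 < \<delta>" "real (card Z) * \<delta> \<le> 1 / 4" unfolding \<delta>_def by (auto simp: divide_simps)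
  obtain K where K: "compact K" "P ` cball 0 lam \<subseteq> K" using finite_rank_compact[OF P] by blast
  obtain Y where Y: "finite Y" "K \<subseteq> (\<Union>y\<in>Y. ball y \<delta>)"
    using compact_finite_net[OF K(1) \<delta>(1)] by blast
  define ublocks where "ublocks u \<longleftrightarrow> (\<forall>a M. 0 \<le> M \<longrightarrow> (\<forall>z\<in>Z. \<bar>a z\<bar> \<le> M) \<longrightarrow> norm (\<Sum>z\<in>Z. a z *\<^sub>R u z) \<le> lam * M)"
    for u :: "'a \<Rightarrow> 'a"
  define C where "C A y = {h. (\<forall>z\<in>Z. lin_on (span A) (\<lambda>x. h (z, x)))} \<inter>
      {h. \<forall>x\<in>span A. norm (P x - (\<Sum>z\<in>Z. h (z, x) *\<^sub>R y z)) \<le> 3 / 4 * norm x}"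
    for A :: "'a set" and y :: "'a \<Rightarrow> 'a"
  define near where "near u y \<longleftrightarrow> (\<forall>z\<in>Z. norm (P (u z) - y z) \<le> \<delta>)" for u y :: "'a \<Rightarrow> 'a"
  define Q where "Q A y \<longleftrightarrow> (\<exists>u. ublocks u \<and> near u y) \<and> (\<exists>h\<in>C A y. \<forall>i. \<bar>h i\<bar> \<le> norm (snd i))" for A y
  have swap: "norm (\<Sum>z\<in>Z. a z *\<^sub>R (P (u z) - y z)) \<le> 1 / 4 * r"
    if "near u y" "\<And>z. z \<in> Z \<Longrightarrow> \<bar>a z\<bar> \<le> r" "0 \<le> r" for u y a r
  proof -
    have "norm (\<Sum>z\<in>Z. a z *\<^sub>R (P (u z) - y z)) \<le> (\<Sum>z\<in>Z. r * \<delta>)"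
      using that unfolding near_def by (intro sum_norm_le) (auto intro!: mult_mono)
    also have "\<dots> = r * (real (card Z) * \<delta>)" by simp
    also have "\<dots> \<le> r * (1 / 4)" using \<delta>(2) that(3) by (intro mult_left_mono)
    finally show ?thesis by simp
  qed
  have CA: "C B y \<subseteq> C A y" if "A \<subseteq> B" for A B y
  proof -
    have "span A \<subseteq> span B" using that by (rule span_mono)
    then show ?thesis unfolding C_def using lin_on_subset[of "span B" _ "span A"] by blast
  qed
  have "\<exists>y\<in>PiE Z (\<lambda>_. Y). \<forall>A. finite A \<longrightarrow> Q A y"
  proof (rule directed_pigeonhole)
    show "finite (PiE Z (\<lambda>_. Y))" using Z(1) Y(1) by (intro finite_PiE) auto
    show "Q A y" if "A \<subseteq> B" "Q B y" for A B y
      using CA[OF that(1)] that(2) unfolding Q_def by blast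
    fix A :: "'a set" assume A: "finite A"
    obtain G n e g where AG: "A \<subseteq> G" and fac: "linf_factor lam G n e g"
      using L_infinity_factor[OF L A] by blast
    have G: "subspace G" and bd: "\<And>c M. 0 \<le> M \<Longrightarrow> (\<forall>i<n. \<bar>c i\<bar> \<le> M) \<Longrightarrow> norm (\<Sum>i<n. c i *\<^sub>R e i) \<le> lam * M"
      using fac unfolding linf_factor_def by blast+
    have "(\<Sum>i<n. norm (P (e i))) \<le> \<kappa> * lam"
      by (rule \<kappa>(2)) (use bd[of 1] in simp)
    from averaging_along_directions[OF fac lin Z this less_imp_le[OF \<eta>(1)]]
    obtain h u where h: "\<And>z. lin_on G (h z)" "\<And>z x. x \<in> G \<Longrightarrow> \<bar>h z x\<bar> \<le> norm x"
      and u: "ublocks u" and hu: "\<And>x. x \<in> G \<Longrightarrow> norm (P x - (\<Sum>z\<in>Z. h z x *\<^sub>R P (u z))) \<le> 2 * \<eta> * (\<kappa> * lam) * norm x"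
      unfolding ublocks_def by blast
    have "\<exists>y\<in>Y. norm (P (u z) - y) \<le> \<delta>" if z: "z \<in> Z" for z
    proof -
      have "(\<Sum>z'\<in>Z. (if z' = z then 1 else 0) *\<^sub>R u z') = u z"
        using Z(1) z by (simp add: if_distrib[of "\<lambda>c. c *\<^sub>R _"] cong: if_cong)
      moreover have "norm (\<Sum>z'\<in>Z. (if z' = z then 1 else 0) *\<^sub>R u z') \<le> lam * 1"
        by (rule u[unfolded ublocks_def, rule_format]) auto
      ultimately have "u z \<in> cball 0 lam" by simp
      then have "P (u z) \<in> K" using K(2) by blast
      then obtain y where "y \<in> Y" "dist y (P (u z)) < \<delta>" using Y(2) by auto
      then show ?thesis by (intro bexI[of _ y]) (auto simp: dist_norm norm_minus_commute)
    qed
    then have "\<forall>z\<in>Z. \<exists>y. y \<in> Y \<and> norm (P (u z) - y) \<le> \<delta>" by blast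
    from bchoice[OF this] obtain y' where y': "\<And>z. z \<in> Z \<Longrightarrow> y' z \<in> Y \<and> norm (P (u z) - y' z) \<le> \<delta>" by blast
    define y where "y = restrict y' Z"
    have yY: "y \<in> PiE Z (\<lambda>_. Y)" unfolding y_def using y' by auto
    have near: "near u y" unfolding near_def y_def using y' by simp
    have spanG: "span A \<subseteq> G" using AG G by (rule span_minimal)
    define h' where "h' i = (if snd i \<in> span A then h (fst i) (snd i) else 0)" for i
    have hz: "lin_on (span A) (\<lambda>x. h' (z, x))" for z
      by (rule lin_on_cong[OF lin_on_subset[OF h(1) spanG] subspace_span]) (simp add: h'_def)
    have "norm (P x - (\<Sum>z\<in>Z. h' (z, x) *\<^sub>R y z)) \<le> 3 / 4 * norm x" if x: "x \<in> span A" for x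
    proof -
      have xG: "x \<in> G" using x spanG by blast
      have "P x - (\<Sum>z\<in>Z. h' (z, x) *\<^sub>R y z) = (P x - (\<Sum>z\<in>Z. h z x *\<^sub>R P (u z))) + (\<Sum>z\<in>Z. h z x *\<^sub>R (P (u z) - y z))"
        using x by (simp add: h'_def scaleR_diff_right sum_subtractf)
      also have "norm \<dots> \<le> 2 * \<eta> * (\<kappa> * lam) * norm x + 1 / 4 * norm x"
        by (intro norm_triangle_mono hu[OF xG] swap[OF near] h(2)[OF xG] norm_ge_zero)
      also have "\<dots> \<le> 1 / 2 * norm x + 1 / 4 * norm x" using \<eta>(2) by (intro add_right_mono mult_right_mono) auto
      finally show ?thesis by simp
    qed
    then have "h' \<in> C A y" unfolding C_def using hz by simp
    moreover have "\<bar>h' i\<bar> \<le> norm (snd i)" for i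
      using h(2)[of "snd i" "fst i"] spanG unfolding h'_def by auto
    ultimately have "Q A y" unfolding Q_def using u near by blast
    with yY show "\<exists>y\<in>PiE Z (\<lambda>_. Y). Q A y" by blast
  qed
  then obtain y where y: "\<And>A. finite A \<Longrightarrow> Q A y" by blast
  then obtain u where u: "ublocks u" and near: "near u y" unfolding Q_def by blast
  have "\<exists>h. (\<forall>i. \<bar>h i\<bar> \<le> norm (snd i)) \<and> (\<forall>A. finite A \<longrightarrow> h \<in> C A y)"
  proof (rule compact_choice)
    show "closed (C A y)" for A unfolding C_def lin_on_def real_scaleR_def
      by (intro closed_Int closed_Collect_Ball closed_Collect_conj closed_Collect_all closed_Collect_eq closed_Collect_le
          continuous_intros continuous_on_product_coordinates)
    show "C B y \<subseteq> C A y" if "A \<subseteq> B" for A B using CA[OF that] .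
    show "\<exists>h\<in>C A y. \<forall>i. \<bar>h i\<bar> \<le> norm (snd i)" if "finite A" for A
      using y[OF that] unfolding Q_def by blast
  qed
  then obtain h where h: "\<And>i. \<bar>h i\<bar> \<le> norm (snd i)" and hC: "\<And>A. finite A \<Longrightarrow> h \<in> C A y" by blast
  have blin: "bounded_linear (\<lambda>x. h (z, x))" if z: "z \<in> Z" for z
  proof (rule bounded_linear_intro[of _ 1])
    fix x x' r
    have "lin_on (span {x, x'}) (\<lambda>x. h (z, x))" using hC[of "{x, x'}"] z unfolding C_def by blast
    moreover have "x \<in> span {x, x'}" "x' \<in> span {x, x'}" by (auto intro: span_base)
    ultimately show "h (z, x + x') = h (z, x) + h (z, x')" "h (z, r *\<^sub>R x) = r *\<^sub>R h (z, x)"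
      unfolding lin_on_def by simp_all
    show "norm (h (z, x)) \<le> norm x * 1" using h[of "(z, x)"] by simp
  qed
  define R where "R x = (\<Sum>z\<in>Z. h (z, x) *\<^sub>R u z)" for x
  have "finite_rank R" unfolding R_def using Z(1) blin by (rule finite_rank_sum)
  moreover have "norm (R x) \<le> lam * norm x" for x
    unfolding R_def by (rule u[unfolded ublocks_def, rule_format]) (use h[of "(_, x)"] in auto)
  moreover have "norm (P x - P (R x)) \<le> norm x" for x
  proof -
    have PR: "P (R x) = (\<Sum>z\<in>Z. h (z, x) *\<^sub>R P (u z))"
      unfolding R_def by (simp add: linear_sum[OF lin] linear_scale[OF lin])
    have "P x - P (R x) = (P x - (\<Sum>z\<in>Z. h (z, x) *\<^sub>R y z)) - (\<Sum>z\<in>Z. h (z, x) *\<^sub>R (P (u z) - y z))"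
      unfolding PR by (simp add: scaleR_diff_right sum_subtractf)
    also have "norm \<dots> \<le> 3 / 4 * norm x + 1 / 4 * norm x"
    proof (rule order_trans[OF norm_triangle_ineq4], rule add_mono)
      have "h \<in> C {x} y" by (rule hC) simp
      then show "norm (P x - (\<Sum>z\<in>Z. h (z, x) *\<^sub>R y z)) \<le> 3 / 4 * norm x"
        unfolding C_def by (simp add: span_base)
      show "norm (\<Sum>z\<in>Z. h (z, x) *\<^sub>R (P (u z) - y z)) \<le> 1 / 4 * norm x"
        by (rule swap[OF near]) (use h[of "(_, x)"] in auto)
    qed
    finally show ?thesis by simp
  qed
  ultimately show ?thesis by blast
qed

section \<open>A chain of commuting finite-rank projections\<close>

text \<open>
  The operator \<open>R' = R + P \<circ> (I - R)\<close> corrects \<open>P \<circ> R \<approx> P\<close> to \<open>P \<circ> R' = P\<close> and adds at most 1 to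
  the norm. If the projection \<open>S\<close> fixes the ranges of \<open>R'\<close> and \<open>P\<close>, then \<open>Q = S + R' \<circ> (I - S)\<close> is
  a projection with the same range as \<open>S\<close>, and \<open>P \<circ> Q = P \<circ> S + P \<circ> (I - S) = P\<close>. The bound on its
  norm depends on \<open>lam\<close> only, and so the step can be iterated.
\<close>

lemma L_infinity_projection_step:
  fixes P :: "'a::banach \<Rightarrow> 'a"
  assumes L: "L_infinity_const_space lam TYPE('a)" and lam: "0 \<le> lam"
    and P: "finite_rank P" and idem: "\<And>x. P (P x) = P x"
  shows "\<exists>Q :: 'a \<Rightarrow> 'a. finite_rank Q \<and> (\<forall>x. norm (Q x) \<le> (lam + (lam + 1) * (1 + lam)) * norm x) \<and>
    (\<forall>x. Q (Q x) = Q x) \<and> (\<forall>x. P (Q x) = P x) \<and> (\<forall>x. Q (P x) = P x) \<and> Q d = d"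
proof -
  have linP: "linear P" using finite_rank_bounded_linear[OF P] by (rule bounded_linear.linear)
  obtain R where R: "finite_rank R" "\<And>x. norm (R x) \<le> lam * norm x" "\<And>x. norm (P x - P (R x)) \<le> norm x"
    using L_infinity_almost_dual_identity[OF L lam P idem] by blast
  define R' where "R' x = R x + (P x - P (R x))" for x
  have frR': "finite_rank R'"
    unfolding R'_def using R(1) P linP by (intro finite_rank_add finite_rank_diff finite_rank_compose_left[of R P])
  have linR': "linear R'" using finite_rank_bounded_linear[OF frR'] by (rule bounded_linear.linear)
  have R'b: "norm (R' x) \<le> (lam + 1) * norm x" for x
    unfolding R'_def using norm_triangle_mono[OF R(2) R(3), of x x] by (simp add: distrib_right)
  have PR': "P (R' x) = P x" for x
    unfolding R'_def by (simp add: linear_add[OF linP] linear_diff[OF linP] idem)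
  obtain B1 B2 where B: "finite B1" "range R' \<subseteq> span B1" "finite B2" "range P \<subseteq> span B2"
    using finite_rank_range[OF frR'] finite_rank_range[OF P] by blast
  define A where "A = insert d (B1 \<union> B2)"
  have "finite A" unfolding A_def using B by simp
  then obtain S where S: "finite_rank S" "\<And>x. norm (S x) \<le> lam * norm x" "\<And>x. S (S x) = S x"
    and SA: "\<And>x. x \<in> span A \<Longrightarrow> S x = x"
    using L_infinity_projection[OF L \<open>finite A\<close>] by blast
  have linS: "linear S" using finite_rank_bounded_linear[OF S(1)] by (rule bounded_linear.linear)
  have "span B1 \<subseteq> span A" "span B2 \<subseteq> span A" unfolding A_def by (intro span_mono; blast)+
  then have SR': "S (R' x) = R' x" and SP: "S (P x) = P x" for x
    using B SA by blast+
  have Sd: "S d = d" by (rule SA) (simp add: A_def span_base)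
  define Q where "Q x = S x + R' (x - S x)" for x
  have QS: "Q x = x" if "S x = x" for x unfolding Q_def using that by (simp add: linear_0[OF linR'])
  have SQ: "S (Q x) = Q x" for x unfolding Q_def by (simp add: linear_add[OF linS] S(3) SR')
  have "bounded_linear (\<lambda>x. x - S x)"
    by (intro bounded_linear_sub bounded_linear_ident finite_rank_bounded_linear S(1))
  then have "finite_rank Q" unfolding Q_def
    by (intro finite_rank_add S(1) finite_rank_compose_right[OF frR'])
  moreover have "norm (Q x) \<le> (lam + (lam + 1) * (1 + lam)) * norm x" for x
  proof -
    have "norm (x - S x) \<le> (1 + lam) * norm x"
      using norm_triangle_ineq4[of x "S x"] S(2)[of x] by (simp add: distrib_right)
    then have "(lam + 1) * norm (x - S x) \<le> (lam + 1) * ((1 + lam) * norm x)"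
      using lam by (intro mult_left_mono) auto
    then have "norm (R' (x - S x)) \<le> (lam + 1) * ((1 + lam) * norm x)"
      using R'b[of "x - S x"] by linarith
    from norm_triangle_mono[OF S(2)[of x] this] show ?thesis unfolding Q_def by (simp add: distrib_right mult.assoc)
  qed
  moreover have "P (Q x) = P x" for x
    unfolding Q_def by (simp add: linear_add[OF linP] linear_diff[OF linP] PR')
  moreover have "Q (P x) = P x" "Q (Q x) = Q x" for x using QS SP SQ by auto
  ultimately show ?thesis using QS[OF Sd] by blast
qed

text \<open>
  A dense sequence \<open>d\<close> is absorbed one vector at a time.
\<close>

lemma L_infinity_projection_chain:
  assumes sep: "separable_space (euclidean :: 'a::banach topology)"
    and L: "L_infinity_const_space lam TYPE('a)" and lam: "1 \<le> lam"
  shows "\<exists>(P :: nat \<Rightarrow> 'a \<Rightarrow> 'a) c. 1 \<le> c \<and> P 0 = (\<lambda>x. 0) \<and> (\<forall>n. finite_rank (P n)) \<and>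
    (\<forall>n x. norm (P n x) \<le> c * norm x) \<and> (\<forall>m n x. P m (P n x) = P (min m n) x) \<and>
    (\<forall>x. \<forall>e>0. \<exists>n y. P n y = y \<and> dist x y < e)"
proof -
  obtain D :: "'a set" where D: "countable D" "closure D = UNIV"
    using sep unfolding separable_space_def by auto
  then have "D \<noteq> {}" by auto
  define d where "d = from_nat_into D"
  have d: "range d = D" unfolding d_def using D(1) \<open>D \<noteq> {}\<close> by (simp add: range_from_nat_into)
  define c where "c = lam + (lam + 1) * (1 + lam)"
  have c: "1 \<le> c" unfolding c_def using lam by (simp add: add_increasing2)
  define good where "good Q \<longleftrightarrow> finite_rank Q \<and> (\<forall>x. norm (Q x) \<le> c * norm x) \<and> (\<forall>x. Q (Q x) = Q x)" for Q :: "'a \<Rightarrow> 'a"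
  have "\<exists>P. \<forall>n. (good (P n) \<and> (n = 0 \<longrightarrow> P n = (\<lambda>x. 0))) \<and>
     ((\<forall>x. P n (P (Suc n) x) = P n x) \<and> (\<forall>x. P (Suc n) (P n x) = P n x) \<and> P (Suc n) (d n) = d n)"
  proof (rule dependent_nat_choice)
    show "\<exists>Q. good Q \<and> ((0::nat) = 0 \<longrightarrow> Q = (\<lambda>x. 0))"
      by (rule exI[of _ "\<lambda>x. 0"]) (use c in \<open>simp add: good_def finite_rank.zero\<close>)
    fix Q :: "'a \<Rightarrow> 'a" and n :: nat
    assume "good Q \<and> (n = 0 \<longrightarrow> Q = (\<lambda>x. 0))"
    then have "finite_rank Q" "\<And>x. Q (Q x) = Q x" unfolding good_def by auto
    from L_infinity_projection_step[OF L _ this, of "d n"] lam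
    show "\<exists>Q'. (good Q' \<and> (Suc n = 0 \<longrightarrow> Q' = (\<lambda>x. 0))) \<and>
        ((\<forall>x. Q (Q' x) = Q x) \<and> (\<forall>x. Q' (Q x) = Q x) \<and> Q' (d n) = d n)"
      unfolding good_def c_def by simp
  qed
  then obtain P where good: "\<And>n. good (P n)" and P0: "P 0 = (\<lambda>x. 0)"
    and down: "\<And>n x. P n (P (Suc n) x) = P n x" and up: "\<And>n x. P (Suc n) (P n x) = P n x"
    and Pd: "\<And>n. P (Suc n) (d n) = d n"
    by blast
  have idem: "P n (P n x) = P n x" for n x using good[of n] unfolding good_def by blast
  have dn: "P m (P (m + k) x) = P m x" for m k x
  proof (induction k arbitrary: x)
    case 0
    then show ?case by (simp add: idem)
  next
    case (Suc k)
    have "P m (P (m + Suc k) x) = P m (P (m + k) (P (m + Suc k) x))" by (simp only: Suc)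
    also have "\<dots> = P m (P (m + k) x)" by (simp add: down)
    finally show ?case by (simp only: Suc)
  qed
  have upk: "P (m + k) (P m x) = P m x" for m k x
  proof (induction k)
    case 0
    then show ?case by (simp add: idem)
  next
    case (Suc k)
    have "P (m + Suc k) (P m x) = P (Suc (m + k)) (P (m + k) (P m x))" by (simp only: Suc add_Suc_right)
    also have "\<dots> = P (m + k) (P m x)" by (rule up)
    finally show ?case by (simp only: Suc)
  qed
  have comp: "P m (P n x) = P (min m n) x" for m n x
  proof (cases "m \<le> n")
    case True
    then show ?thesis using dn[of m "n - m" x] by (simp add: min_absorb1)
  next
    case False
    then show ?thesis using upk[of n "m - n" x] by (simp add: min_absorb2)
  qed
  have dense: "\<exists>n y. P n y = y \<and> dist x y < e" if "0 < e" for x e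
  proof -
    have "x \<in> closure D" using D(2) by simp
    then have "\<exists>y\<in>D. dist y x < e" using that by (simp only: closure_approachable)
    then obtain y where "y \<in> D" "dist y x < e" by blast
    moreover from \<open>y \<in> D\<close> obtain n where "y = d n" using d by blast
    ultimately have "P (Suc n) y = y" "dist x y < e" using Pd by (auto simp: dist_commute)
    then show ?thesis by blast
  qed
  have "\<And>n. finite_rank (P n)" "\<And>n x. norm (P n x) \<le> c * norm x"
    using good unfolding good_def by blast+
  with c P0 comp dense show ?thesis by (intro exI[of _ P] exI[of _ c] conjI allI impI)
qed

section \<open>Clipping to a ball\<close>

text \<open>
  Radial retractions divide by a number \<open>a \<ge> 1\<close> that depends on the point. A change of this number
  moves the quotient by at most the size \<open>T\<close> of the quotient times the change.
\<close>

lemma quotient_lipschitz: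
  fixes x y :: "'a::real_normed_vector"
  assumes a: "1 \<le> a" and b: "1 \<le> b" and y: "norm y \<le> T * b" and ab: "\<bar>a - b\<bar> \<le> \<delta>"
  shows "norm ((1 / a) *\<^sub>R x - (1 / b) *\<^sub>R y) \<le> norm (x - y) + T * \<delta>"
proof -
  have T: "0 \<le> T" using y b norm_ge_zero[of y] by (smt (verit) mult_neg_pos)
  have "(1 / a) *\<^sub>R x - (1 / b) *\<^sub>R y = (1 / a) *\<^sub>R (x - y) + ((b - a) / a) *\<^sub>R (1 / b) *\<^sub>R y"
  proof -
    have "(b - a) / a * (1 / b) = 1 / a - 1 / b" using a b by (simp add: field_simps)
    then show ?thesis by (simp only: scaleR_scaleR scaleR_diff_right scaleR_diff_left) simp
  qed
  also have "norm \<dots> \<le> norm (x - y) + \<delta> * T"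
  proof (rule norm_triangle_mono)
    have "norm ((1 / a) *\<^sub>R (x - y)) = norm (x - y) / a" using a by simp
    also have "\<dots> \<le> norm (x - y)" using a by (simp add: pos_divide_le_eq mult_le_cancel_left1)
    finally show "norm ((1 / a) *\<^sub>R (x - y)) \<le> norm (x - y)" .
    have "\<bar>(b - a) / a\<bar> = \<bar>a - b\<bar> / a" using a by (simp add: abs_minus_commute)
    also have "\<dots> \<le> \<bar>a - b\<bar>" using a by (simp add: pos_divide_le_eq mult_le_cancel_left1)
    finally have 1: "\<bar>(b - a) / a\<bar> \<le> \<delta>" using ab by simp
    have 2: "norm ((1 / b) *\<^sub>R y) \<le> T" using b y by (simp add: pos_divide_le_eq)
    show "norm (((b - a) / a) *\<^sub>R (1 / b) *\<^sub>R y) \<le> \<delta> * T"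
      unfolding norm_scaleR[of "(b - a) / a"] by (rule mult_mono[OF 1 2]) (use ab in auto)
  qed
  finally show ?thesis by (simp add: mult.commute)
qed

text \<open>
  The radial retraction onto the ball of radius \<open>s\<close>. For \<open>s = 0\<close> it is constantly 0, also at
  \<open>v = 0\<close>, where the quotient is \<open>0 / 0 = 0\<close>.
\<close>

definition clip :: "real \<Rightarrow> 'a::real_normed_vector \<Rightarrow> 'a" where
  "clip s v = (s / max s (norm v)) *\<^sub>R v"

lemma clip_zero [simp]: "clip 0 v = 0"
  by (simp add: clip_def)

lemma clip_fix: "norm v \<le> s \<Longrightarrow> clip s v = v"
  by (cases "s = 0") (auto simp: clip_def max_def)

lemma clip_outside: "s \<le> norm v \<Longrightarrow> clip s v = (s / norm v) *\<^sub>R v"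
  by (simp add: clip_def max_def)

lemma norm_clip: "0 \<le> s \<Longrightarrow> norm (clip s v) = min s (norm v)"
  by (cases "s \<le> norm v") (auto simp: clip_outside clip_fix)

lemma clip_clip:
  assumes "0 \<le> s" "0 \<le> t"
  shows "clip s (clip t v) = clip (min s t) v"
proof (cases "norm v \<le> t")
  case True
  then show ?thesis by (cases "s \<le> t") (auto simp: clip_fix min_def)
next
  case False
  then have v: "clip t v = (t / norm v) *\<^sub>R v" "norm (clip t v) = t"
    using assms by (auto simp: clip_outside norm_clip)
  show ?thesis
  proof (cases "s \<le> t")
    case True
    then have "clip s (clip t v) = (s / t) *\<^sub>R clip t v" using v by (simp add: clip_outside)
    also have "\<dots> = (s / norm v) *\<^sub>R v" unfolding v(1) using True assms by (cases "t = 0") auto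
    finally show ?thesis using True False by (simp add: clip_outside)
  next
    case False
    then show ?thesis using v by (simp add: clip_fix)
  qed
qed

lemma clip_lipschitz:
  assumes "0 \<le> s"
  shows "norm (clip s v - clip s w) \<le> 2 * norm (v - w)"
proof (cases "s = 0")
  case False
  with assms have s: "0 < s" by simp
  have c: "clip s v = (1 / max 1 (norm v / s)) *\<^sub>R v" for v :: 'a
  proof -
    have "max s (norm v) = s * max 1 (norm v / s)" using s by (simp add: max_mult_distrib_left)
    then show ?thesis unfolding clip_def using s by simp
  qed
  have "norm w \<le> s * max 1 (norm w / s)" using s by (simp add: max_mult_distrib_left)
  moreover have "\<bar>max 1 (norm v / s) - max 1 (norm w / s)\<bar> \<le> norm (v - w) / s"
  proof -
    have "\<bar>norm v / s - norm w / s\<bar> = \<bar>norm v - norm w\<bar> / s" using s by (simp add: diff_divide_distrib[symmetric])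
    also have "\<dots> \<le> norm (v - w) / s" using s by (intro divide_right_mono norm_triangle_ineq3) auto
    finally show ?thesis by linarith
  qed
  ultimately have "norm (clip s v - clip s w) \<le> norm (v - w) + s * (norm (v - w) / s)"
    unfolding c by (intro quotient_lipschitz) auto
  then show ?thesis using s by simp
qed simp

lemma clip_radius:
  assumes "0 \<le> s" "s \<le> t"
  shows "norm (clip t v - clip s v) \<le> t - s"
proof -
  define w where "w = clip t v"
  have w: "norm w \<le> t" "clip s v = clip s w" using assms by (auto simp: w_def norm_clip clip_clip min_absorb1)
  show ?thesis
  proof (cases "norm w \<le> s")
    case True
    then show ?thesis using w assms by (simp add: clip_fix w_def[symmetric])
  next
    case False
    then have "w - clip s w = (1 - s / norm w) *\<^sub>R w" by (simp add: clip_outside scaleR_diff_left)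
    then have "norm (w - clip s w) = \<bar>1 - s / norm w\<bar> * norm w" by simp
    also have "\<dots> = norm w - s"
    proof -
      have "0 < norm w" "s \<le> norm w" using False assms by linarith+
      then have "\<bar>1 - s / norm w\<bar> = 1 - s / norm w" by (simp add: divide_le_eq_1)
      then show ?thesis using \<open>0 < norm w\<close> by (simp add: left_diff_distrib)
    qed
    finally show ?thesis using w by (simp add: w_def[symmetric])
  qed
qed

section \<open>Commuting Lipschitz retractions with small steps\<close>

text \<open>
  The retractions are built in stages. In stage \<open>k\<close> one first projects to the range of \<open>P (k + 1)\<close>
  and scales to \<open>body k\<close> (\<open>shrink\<close>), and then clips the component \<open>P (k + 1) v - P k v\<close> to a
  radius that runs through \<open>0, 2, \<dots>, 4 * k\<close> (\<open>cyl\<close>, for the cylinder-shaped image). At radius 0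
  only the range of \<open>P k\<close> is left, and the previous stage takes over.
\<close>

locale projection_chain =
  fixes P :: "nat \<Rightarrow> 'a::real_normed_vector \<Rightarrow> 'a" and c :: real
  assumes lin: "\<And>n. linear (P n)"
    and bound: "\<And>n x. norm (P n x) \<le> c * norm x" and c: "0 \<le> c"
    and comp: "\<And>m n x. P m (P n x) = P (min m n) x"
begin

text \<open>
  This is what makes the scalings of different stages commute. Coming down to stage \<open>k\<close>, each
  stage \<open>j \<ge> k\<close> scales a vector of the range of \<open>P (j + 1)\<close> until all its projections have norm at
  most \<open>j + 1\<close>. Every scaling multiplies the vector by a factor, and the product of all these
  factors is \<open>1 / max 1 (gauge k y)\<close>. As a supremum of seminorms, the gauge is Lipschitz, with
  constant \<open>c / (k + 1)\<close>. Since the vectors of \<open>body k\<close> have norm at most \<open>k + 1\<close>, the scaling by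
  this factor has a Lipschitz constant that is independent of \<open>k\<close>.
\<close>

definition gauge :: "nat \<Rightarrow> 'a \<Rightarrow> real" where
  "gauge k y = (SUP i. norm (P i y) / real (max (Suc k) i))"

definition shrink :: "nat \<Rightarrow> 'a \<Rightarrow> 'a" where
  "shrink k y = (1 / max 1 (gauge k y)) *\<^sub>R P (Suc k) y"

definition cyl :: "nat \<Rightarrow> real \<Rightarrow> 'a \<Rightarrow> 'a" where
  "cyl k s v = P k v + clip s (P (Suc k) v - P k v)"

definition body :: "nat \<Rightarrow> 'a set" where
  "body k = {v. P (Suc k) v = v \<and> (\<forall>i. norm (P i v) \<le> real (Suc k))}"

lemma gauge_bdd: "bdd_above (range (\<lambda>i. norm (P i y) / real (max (Suc k) i)))"
proof (rule bdd_aboveI2)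
  fix i
  have "norm (P i y) / real (max (Suc k) i) \<le> norm (P i y) / 1" by (intro divide_left_mono) auto
  then show "norm (P i y) / real (max (Suc k) i) \<le> c * norm y" using bound[of i y] by simp
qed

lemma gauge_ge: "norm (P i y) \<le> gauge k y * real (max (Suc k) i)"
proof -
  have "norm (P i y) / real (max (Suc k) i) \<le> gauge k y"
    unfolding gauge_def by (rule cSUP_upper[OF _ gauge_bdd]) simp
  then show ?thesis by (simp add: pos_divide_le_eq)
qed

lemma gauge_le: "(\<And>i. norm (P i y) \<le> m * real (max (Suc k) i)) \<Longrightarrow> gauge k y \<le> m"
  unfolding gauge_def by (intro cSUP_least) (auto simp: pos_divide_le_eq)

lemma gauge_nonneg: "0 \<le> gauge k y"
  using gauge_ge[of 0 y k] norm_ge_zero[of "P 0 y"] by (smt (verit) mult_neg_pos of_nat_0_less_iff max.strict_coboundedI1 zero_less_Suc)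

lemma gauge_lipschitz: "\<bar>gauge k y - gauge k z\<bar> \<le> c / real (Suc k) * norm (y - z)"
proof -
  have le: "gauge k y \<le> gauge k z + c / real (Suc k) * norm (y - z)" for y z
  proof (rule gauge_le)
    fix i
    have m: "1 \<le> real (max (Suc k) i) / real (Suc k)" by simp
    have "P i y = P i z + P i (y - z)" by (simp add: linear_diff[OF lin])
    then have "norm (P i y) \<le> gauge k z * real (max (Suc k) i) + c * norm (y - z)"
      using norm_triangle_mono[OF gauge_ge bound] by metis
    also have "c * norm (y - z) \<le> c * norm (y - z) * (real (max (Suc k) i) / real (Suc k))"
      using mult_left_mono[OF m, of "c * norm (y - z)"] c by simp
    finally show "norm (P i y) \<le> (gauge k z + c / real (Suc k) * norm (y - z)) * real (max (Suc k) i)"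
      by (simp add: algebra_simps)
  qed
  from le[of y z] le[of z y] show ?thesis by (simp add: norm_minus_commute abs_le_iff)
qed

lemma gauge_scale:
  assumes "0 < r"
  shows "gauge k (r *\<^sub>R y) = r * gauge k y"
proof (rule antisym)
  have le: "gauge k (r *\<^sub>R y) \<le> r * gauge k y" if "0 < r" for r y
  proof (rule gauge_le)
    fix i
    show "norm (P i (r *\<^sub>R y)) \<le> r * gauge k y * real (max (Suc k) i)"
      using gauge_ge[of i y k] that by (simp add: linear_scale[OF lin] mult.assoc)
  qed
  show "gauge k (r *\<^sub>R y) \<le> r * gauge k y" using le[OF assms] .
  have "gauge k ((1 / r) *\<^sub>R r *\<^sub>R y) \<le> 1 / r * gauge k (r *\<^sub>R y)" by (rule le) (use assms in simp)
  then show "r * gauge k y \<le> gauge k (r *\<^sub>R y)" using assms by (simp add: field_simps)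
qed

text \<open>
  Scaling in stage \<open>k + 1\<close> takes care of the norms of \<open>P i y\<close> for \<open>i > k + 1\<close>, and scaling the
  projection in stage \<open>k\<close> of those for \<open>i \<le> k + 1\<close>.
\<close>

lemma gauge_split: "max (gauge (Suc k) y) (gauge k (P (Suc k) y)) = gauge k y"
proof (rule antisym)
  show "gauge k y \<le> max (gauge (Suc k) y) (gauge k (P (Suc k) y))"
  proof (rule gauge_le)
    fix i
    have *: "a * real (max (Suc k) i) \<le> max a b * real (max (Suc k) i)" "b * real (max (Suc k) i) \<le> max a b * real (max (Suc k) i)" for a b
      by (intro mult_right_mono; simp)+
    show "norm (P i y) \<le> max (gauge (Suc k) y) (gauge k (P (Suc k) y)) * real (max (Suc k) i)"
    proof (cases "i \<le> Suc k")
      case True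
      then have "norm (P i y) \<le> gauge k (P (Suc k) y) * real (max (Suc k) i)"
        using gauge_ge[of i "P (Suc k) y" k] by (simp add: comp min_absorb1)
      then show ?thesis using *(2) by (rule order_trans)
    next
      case False
      then have "max (Suc (Suc k)) i = max (Suc k) i" by simp
      then have "norm (P i y) \<le> gauge (Suc k) y * real (max (Suc k) i)"
        using gauge_ge[of i y "Suc k"] by simp
      then show ?thesis using *(1) by (rule order_trans)
    qed
  qed
  have "gauge (Suc k) y \<le> gauge k y"
  proof (rule gauge_le)
    fix i
    have "gauge k y * real (max (Suc k) i) \<le> gauge k y * real (max (Suc (Suc k)) i)"
      by (intro mult_left_mono gauge_nonneg) simp
    with gauge_ge show "norm (P i y) \<le> gauge k y * real (max (Suc (Suc k)) i)" by (rule order_trans)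
  qed
  moreover have "gauge k (P (Suc k) y) \<le> gauge k y"
  proof (rule gauge_le)
    fix i
    have "gauge k y * real (max (Suc k) (min i (Suc k))) \<le> gauge k y * real (max (Suc k) i)"
      by (intro mult_left_mono gauge_nonneg) simp
    with gauge_ge show "norm (P i (P (Suc k) y)) \<le> gauge k y * real (max (Suc k) i)"
      unfolding comp by (rule order_trans)
  qed
  ultimately show "max (gauge (Suc k) y) (gauge k (P (Suc k) y)) \<le> gauge k y" by simp
qed

lemma shrink_range: "P (Suc k) (shrink k y) = shrink k y"
  unfolding shrink_def by (simp add: linear_scale[OF lin] comp)

lemma shrink_body: "shrink k y \<in> body k"
proof -
  have "norm (P i (shrink k y)) \<le> real (Suc k)" for i
  proof -
    define a where "a = max 1 (gauge k y)"
    have a: "1 \<le> a" "gauge k y \<le> a" unfolding a_def by auto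
    have "norm (P (min i (Suc k)) y) \<le> gauge k y * real (max (Suc k) (min i (Suc k)))" by (rule gauge_ge)
    also have "max (Suc k) (min i (Suc k)) = Suc k" by simp
    also have "gauge k y * real (Suc k) \<le> a * real (Suc k)" using a by (intro mult_right_mono) auto
    finally have "norm (P (min i (Suc k)) y) / a \<le> real (Suc k)" using a by (simp add: pos_divide_le_eq mult.commute)
    moreover have "norm (P i (shrink k y)) = norm (P (min i (Suc k)) y) / a"
      unfolding shrink_def a_def[symmetric] using a by (simp add: linear_scale[OF lin] comp)
    ultimately show ?thesis by simp
  qed
  with shrink_range show ?thesis unfolding body_def by simp
qed

lemma shrink_fix:
  assumes "P (Suc k) z = z" "gauge k z \<le> 1"
  shows "shrink k z = z"
  unfolding shrink_def using assms by (simp add: max_absorb1)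

lemma body_gauge:
  assumes "v \<in> body k" shows "gauge k v \<le> 1"
proof (rule gauge_le)
  fix i
  have "norm (P i v) \<le> real (Suc k)" using assms unfolding body_def by blast
  also have "\<dots> \<le> 1 * real (max (Suc k) i)" by simp
  finally show "norm (P i v) \<le> 1 * real (max (Suc k) i)" .
qed

lemma shrink_body_fix: "v \<in> body k \<Longrightarrow> shrink k v = v"
  using body_gauge by (intro shrink_fix) (auto simp: body_def)

lemma shrink_lipschitz: "norm (shrink k y - shrink k z) \<le> 2 * c * norm (y - z)"
proof -
  have "norm (P (Suc k) z) \<le> gauge k z * real (Suc k)" using gauge_ge[of "Suc k" z k] by simp
  also have "\<dots> \<le> real (Suc k) * max 1 (gauge k z)" by (simp add: mult.commute mult_right_mono)
  finally have 1: "norm (P (Suc k) z) \<le> real (Suc k) * max 1 (gauge k z)" .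
  have 2: "\<bar>max 1 (gauge k y) - max 1 (gauge k z)\<bar> \<le> c / real (Suc k) * norm (y - z)"
    using gauge_lipschitz[of k y z] by linarith
  have "norm (shrink k y - shrink k z) \<le> norm (P (Suc k) y - P (Suc k) z) + real (Suc k) * (c / real (Suc k) * norm (y - z))"
    unfolding shrink_def by (rule quotient_lipschitz[OF _ _ 1 2]) auto
  also have "norm (P (Suc k) y - P (Suc k) z) \<le> c * norm (y - z)"
    using bound[of "Suc k" "y - z"] by (simp add: linear_diff[OF lin])
  finally show ?thesis by simp
qed

text \<open>
  The factors of the two stages multiply to
  \<open>max (max 1 (gauge (k + 1) y)) (gauge k (P (k + 1) y)) = max 1 (gauge k y)\<close>.
\<close>

lemma shrink_shrink: "shrink k (P (Suc k) (shrink (Suc k) y)) = shrink k y"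
proof -
  define a where "a = max 1 (gauge (Suc k) y)"
  have a: "1 \<le> a" unfolding a_def by simp
  have u: "P (Suc k) (shrink (Suc k) y) = (1 / a) *\<^sub>R P (Suc k) y"
    unfolding shrink_def a_def[symmetric] by (simp add: linear_scale[OF lin] comp min_absorb1)
  have "a * max 1 (gauge k ((1 / a) *\<^sub>R P (Suc k) y)) = max a (gauge k (P (Suc k) y))"
    using a by (simp add: gauge_scale max_mult_distrib_left)
  also have "\<dots> = max 1 (gauge k y)" unfolding a_def gauge_split[of k y, symmetric] by (simp add: max.assoc)
  finally have m: "max 1 (gauge k ((1 / a) *\<^sub>R P (Suc k) y)) * a = max 1 (gauge k y)" by (simp add: mult.commute)
  have "shrink k ((1 / a) *\<^sub>R P (Suc k) y) = (1 / (max 1 (gauge k ((1 / a) *\<^sub>R P (Suc k) y)) * a)) *\<^sub>R P (Suc k) y"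
    unfolding shrink_def by (simp add: linear_scale[OF lin] comp)
  then show ?thesis unfolding u m by (simp add: shrink_def)
qed

lemma P_clip: "P i (clip s v) = (s / max s (norm v)) *\<^sub>R P i v"
  unfolding clip_def by (simp add: linear_scale[OF lin])

lemma cyl_low: "i \<le> k \<Longrightarrow> P i (cyl k s v) = P i v"
  unfolding cyl_def by (simp add: linear_add[OF lin] P_clip linear_diff[OF lin] comp min_absorb1)

lemma cyl_high: "Suc k \<le> i \<Longrightarrow> P i (cyl k s v) = cyl k s v"
  unfolding cyl_def by (simp add: linear_add[OF lin] P_clip linear_diff[OF lin] linear_scale[OF lin] comp min_absorb2 clip_def)

text \<open>
  Clipping moves \<open>v\<close> along the segment from \<open>v\<close> to \<open>P k v\<close>, and both ends satisfy the norm bounds.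
\<close>

lemma cyl_body:
  assumes s: "0 \<le> s" and v: "v \<in> body k"
  shows "cyl k s v \<in> body k"
proof -
  have Pv: "P (Suc k) v = v" and nv: "norm (P i v) \<le> real (Suc k)" for i
    using v unfolding body_def by auto
  define t where "t = s / max s (norm (v - P k v))"
  have t: "0 \<le> t" "t \<le> 1" unfolding t_def using s by (auto simp: divide_le_eq_1)
  have "cyl k s v = (1 - t) *\<^sub>R P k v + t *\<^sub>R P (Suc k) v"
    unfolding cyl_def clip_def Pv t_def[symmetric] by (simp add: algebra_simps)
  also have "norm \<dots> \<le> (1 - t) * real (Suc k) + t * real (Suc k)"
    using t nv[of k] nv[of "Suc k"] by (intro norm_triangle_mono) (auto intro!: mult_left_mono)
  finally have "norm (cyl k s v) \<le> real (Suc k)" by (simp add: algebra_simps)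
  then have "norm (P i (cyl k s v)) \<le> real (Suc k)" for i
    using nv[of i] by (cases "i \<le> k") (auto simp: cyl_low cyl_high)
  then show ?thesis unfolding body_def by (simp add: cyl_high)
qed

lemma cyl_cyl: "0 \<le> s \<Longrightarrow> 0 \<le> t \<Longrightarrow> cyl k s (cyl k t v) = cyl k (min s t) v"
proof -
  assume "0 \<le> s" "0 \<le> t"
  have "P (Suc k) (cyl k t v) - P k (cyl k t v) = clip t (P (Suc k) v - P k v)"
    by (simp add: cyl_low cyl_high comp) (simp add: cyl_def)
  then have "cyl k s (cyl k t v) = P k v + clip s (clip t (P (Suc k) v - P k v))"
    by (subst cyl_def) (simp add: cyl_low)
  then show ?thesis unfolding clip_clip[OF \<open>0 \<le> s\<close> \<open>0 \<le> t\<close>] cyl_def .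
qed

lemma cyl_lipschitz:
  assumes "0 \<le> s"
  shows "norm (cyl k s v - cyl k s w) \<le> 5 * c * norm (v - w)"
proof -
  have "cyl k s v - cyl k s w = P k (v - w) + (clip s (P (Suc k) v - P k v) - clip s (P (Suc k) w - P k w))"
    unfolding cyl_def by (simp add: linear_diff[OF lin])
  also have "norm \<dots> \<le> c * norm (v - w) + 2 * norm ((P (Suc k) v - P k v) - (P (Suc k) w - P k w))"
    by (intro norm_triangle_mono bound clip_lipschitz assms)
  also have "(P (Suc k) v - P k v) - (P (Suc k) w - P k w) = P (Suc k) (v - w) - P k (v - w)"
    by (simp add: linear_diff[OF lin])
  also have "norm \<dots> \<le> c * norm (v - w) + c * norm (v - w)"
    by (intro order_trans[OF norm_triangle_ineq4] add_mono bound)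
  finally show ?thesis by simp
qed

text \<open>
  Stage \<open>k\<close> has the \<open>2 * k + 1\<close> steps \<open>t = 0, \<dots>, 2 * k\<close>. Since the first \<open>k\<close> stages have \<open>k\<^sup>2\<close>
  steps in total, the step \<open>t\<close> of stage \<open>k\<close> gets the index \<open>k\<^sup>2 + t\<close>.
\<close>

definition retr :: "nat \<Rightarrow> 'a \<Rightarrow> 'a" where
  "retr n x = (let k = floor_sqrt n in cyl k (2 * real (n - k\<^sup>2)) (shrink k x))"

lemma retr_eq: "t \<le> 2 * k \<Longrightarrow> retr (k\<^sup>2 + t) x = cyl k (2 * real t) (shrink k x)"
proof -
  assume "t \<le> 2 * k"
  then have "floor_sqrt (k\<^sup>2 + t) = k" by (intro floor_sqrt_unique) (auto simp: power2_eq_square)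
  then show ?thesis unfolding retr_def by simp
qed

lemma retr_index: fixes n :: nat obtains k t where "n = k\<^sup>2 + t" "t \<le> 2 * k"
proof
  show "n = (floor_sqrt n)\<^sup>2 + (n - (floor_sqrt n)\<^sup>2)" by simp
  show "n - (floor_sqrt n)\<^sup>2 \<le> 2 * floor_sqrt n"
    using Suc_floor_sqrt_power2_gt[of n] by (simp add: power2_eq_square)
qed

lemma index_Suc:
  assumes "n = k\<^sup>2 + t" "t \<le> 2 * k"
  obtains (inner) "Suc n = k\<^sup>2 + Suc t" "Suc t \<le> 2 * k" | (outer) "t = 2 * k" "Suc n = (Suc k)\<^sup>2 + 0"
  using assms by (cases "t = 2 * k") (auto simp: power2_eq_square)

lemma retr_in_body: "t \<le> 2 * k \<Longrightarrow> retr (k\<^sup>2 + t) x \<in> body k"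
  by (simp add: retr_eq cyl_body shrink_body)

lemma retr_outer: "retr ((Suc k)\<^sup>2 + 0) x = P (Suc k) (shrink (Suc k) x)"
  by (subst retr_eq) (simp_all add: cyl_def)

lemma retr_idem: "retr n (retr n x) = retr n x"
proof -
  obtain k t where n: "n = k\<^sup>2 + t" "t \<le> 2 * k" by (rule retr_index)
  show ?thesis using retr_in_body[OF n(2)] unfolding n(1)
    by (simp add: retr_eq[OF n(2)] shrink_body_fix cyl_cyl)
qed

text \<open>
  Within a stage the smaller clipping radius wins; between two stages the scalings combine by
  \<open>shrink_shrink\<close>.
\<close>

lemma retr_down: "retr n (retr (Suc n) x) = retr n x"
proof -
  obtain k t where n: "n = k\<^sup>2 + t" "t \<le> 2 * k" by (rule retr_index)
  show ?thesis using n
  proof (cases rule: index_Suc)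
    case inner
    have "shrink k (retr (Suc n) x) = retr (Suc n) x"
      unfolding inner(1) by (rule shrink_body_fix) (rule retr_in_body[OF inner(2)])
    then have "retr n (retr (Suc n) x) = cyl k (2 * real t) (retr (Suc n) x)"
      unfolding n(1) by (simp only: retr_eq[OF n(2)])
    also have "\<dots> = retr n x" unfolding inner(1) unfolding n(1) retr_eq[OF inner(2)] retr_eq[OF n(2)]
      by (subst cyl_cyl) (auto simp: min_absorb1)
    finally show ?thesis .
  next
    case outer
    show ?thesis unfolding outer(2) retr_outer unfolding n(1) by (simp only: retr_eq[OF n(2)] shrink_shrink)
  qed
qed

lemma retr_up: "retr (Suc n) (retr n x) = retr n x"
proof -
  obtain k t where n: "n = k\<^sup>2 + t" "t \<le> 2 * k" by (rule retr_index)
  define z where "z = retr n x"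
  have z: "z \<in> body k" unfolding z_def n(1) by (rule retr_in_body[OF n(2)])
  have "retr (Suc n) z = z" using n
  proof (cases rule: index_Suc)
    case inner
    have "retr (Suc n) z = cyl k (2 * real (Suc t)) z"
      unfolding inner(1) retr_eq[OF inner(2)] by (simp only: shrink_body_fix[OF z])
    also have "\<dots> = z" unfolding z_def n(1) retr_eq[OF n(2)]
      by (subst cyl_cyl) (auto simp: min_absorb2)
    finally show ?thesis .
  next
    case outer
    have Pz: "P (Suc k) z = z" using z unfolding body_def by blast
    have "P (Suc (Suc k)) z = P (Suc (Suc k)) (P (Suc k) z)" by (simp only: Pz)
    also have "\<dots> = z" unfolding comp using Pz by simp
    finally have "P (Suc (Suc k)) z = z" .
    moreover have "gauge (Suc k) z \<le> 1" using gauge_split[of k z] body_gauge[OF z] by linarith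
    ultimately have "shrink (Suc k) z = z" by (rule shrink_fix)
    then show ?thesis unfolding outer(2) retr_outer using Pz by simp
  qed
  then show ?thesis unfolding z_def .
qed

lemma retr_lipschitz: "norm (retr n x - retr n y) \<le> 10 * c\<^sup>2 * norm (x - y)"
proof -
  obtain k t where n: "n = k\<^sup>2 + t" "t \<le> 2 * k" by (rule retr_index)
  have "norm (retr n x - retr n y) \<le> 5 * c * norm (shrink k x - shrink k y)"
    unfolding n(1) retr_eq[OF n(2)] by (rule cyl_lipschitz) simp
  also have "\<dots> \<le> 5 * c * (2 * c * norm (x - y))"
    using c by (intro mult_left_mono shrink_lipschitz) auto
  finally show ?thesis by (simp add: power2_eq_square)
qed

text \<open>
  Within a stage only the clipping radius changes, by 2. Between stages, \<open>u\<close> is scaled from norm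
  at most \<open>k + 2\<close> into \<open>body k\<close>, which moves it by at most 1; its new component then has norm at
  most \<open>2 * k + 2\<close>, which exceeds the largest clipping radius \<open>4 * k\<close> by at most 2.
\<close>

lemma retr_step: "norm (retr (Suc n) x - retr n x) \<le> 3"
proof -
  obtain k t where n: "n = k\<^sup>2 + t" "t \<le> 2 * k" by (rule retr_index)
  show ?thesis using n
  proof (cases rule: index_Suc)
    case inner
    have "retr (Suc n) x - retr n x = clip (2 * real (Suc t)) (P (Suc k) (shrink k x) - P k (shrink k x))
        - clip (2 * real t) (P (Suc k) (shrink k x) - P k (shrink k x))"
      unfolding inner(1) unfolding n(1) retr_eq[OF inner(2)] retr_eq[OF n(2)] by (simp add: cyl_def)
    also have "norm \<dots> \<le> 2 * real (Suc t) - 2 * real t" by (rule clip_radius) auto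
    finally show ?thesis by simp
  next
    case outer
    define u where "u = retr (Suc n) x"
    define v where "v = shrink k u"
    have u: "u \<in> body (Suc k)" unfolding u_def outer(2) by (rule retr_in_body) simp
    have Pu: "P (Suc k) u = u" unfolding u_def outer(2) retr_outer by (simp add: comp)
    have un: "norm (P i u) \<le> real (Suc (Suc k))" for i using u unfolding body_def by blast
    define a where "a = max 1 (gauge k u)"
    have "gauge k u \<le> real (Suc (Suc k)) / real (Suc k)"
    proof (rule gauge_le)
      fix i
      have "real (Suc (Suc k)) / real (Suc k) * real (Suc k) \<le> real (Suc (Suc k)) / real (Suc k) * real (max (Suc k) i)"
        by (intro mult_left_mono) auto
      with un[of i] show "norm (P i u) \<le> real (Suc (Suc k)) / real (Suc k) * real (max (Suc k) i)" by simp
    qed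
    then have a: "1 \<le> a" "a \<le> real (Suc (Suc k)) / real (Suc k)" unfolding a_def by (auto simp: field_simps)
    have "u - v = (1 - 1 / a) *\<^sub>R u" unfolding v_def shrink_def Pu a_def[symmetric] by (simp add: scaleR_diff_left)
    also have "norm \<dots> = (1 - 1 / a) * norm u" using a by simp
    also have "\<dots> \<le> (1 - real (Suc k) / real (Suc (Suc k))) * real (Suc (Suc k))"
    proof (rule mult_mono)
      show "norm u \<le> real (Suc (Suc k))" using un[of "Suc k"] Pu by simp
      show "1 - 1 / a \<le> 1 - real (Suc k) / real (Suc (Suc k))" using a by (simp add: field_simps)
      show "0 \<le> 1 - real (Suc k) / real (Suc (Suc k))" by (simp add: field_simps)
    qed simp
    also have "\<dots> = 1" by (simp add: field_simps)
    finally have uv: "norm (u - v) \<le> 1" .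
    have v: "v \<in> body k" unfolding v_def by (rule shrink_body)
    then have Pv: "P (Suc k) v = v" and vn: "norm (P i v) \<le> real (Suc k)" for i unfolding body_def by auto
    define D where "D = P (Suc k) v - P k v"
    have Dn: "norm D \<le> 2 * real (Suc k)"
      unfolding D_def using norm_triangle_ineq4[of "P (Suc k) v" "P k v"] vn[of "Suc k"] vn[of k] by simp
    have "norm (D - clip (4 * real k) D) \<le> 2"
    proof (cases "norm D \<le> 4 * real k")
      case True
      then show ?thesis by (simp add: clip_fix)
    next
      case False
      have "norm (clip (2 * real (Suc k)) D - clip (4 * real k) D) \<le> 2 * real (Suc k) - 4 * real k"
        using False Dn by (intro clip_radius) auto
      then show ?thesis using clip_fix[OF Dn] by simp
    qed
    moreover have "retr n x = cyl k (4 * real k) v"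
    proof -
      have "retr n x = retr n u" unfolding u_def by (simp only: retr_down)
      also have "\<dots> = cyl k (2 * real t) v" unfolding n(1) retr_eq[OF n(2)] v_def ..
      finally show ?thesis using outer(1) by simp
    qed
    then have "v - retr n x = D - clip (4 * real k) D" unfolding cyl_def D_def Pv by simp
    ultimately have "norm (v - retr n x) \<le> 2" by simp
    with uv norm_triangle_mono[of "u - v" 1 "v - retr n x" 2] show ?thesis unfolding u_def by simp
  qed
qed

lemma retr_0: "P 0 = (\<lambda>x. 0) \<Longrightarrow> retr 0 x = 0"
  using retr_eq[of 0 0 x] by (simp add: cyl_def)

lemma retr_exhausts:
  assumes "P m y = y"
  shows "\<exists>n. retr n y = y"
proof -
  define k where "k = max m (nat \<lceil>c * norm y\<rceil>)"
  have m: "m \<le> k" and ck: "c * norm y \<le> real k" unfolding k_def by (auto simp: le_max_iff_disj) linarith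
  have Pi: "P i y = y" if "m \<le> i" for i
    using comp[of i m y] assms that by (simp add: min_absorb2)
  have "norm (P i y) \<le> real (Suc k)" for i using bound[of i y] ck by simp
  then have "y \<in> body k" unfolding body_def using Pi[of "Suc k"] m by simp
  then have "shrink k y = y" by (rule shrink_body_fix)
  then have "retr (k\<^sup>2 + 0) y = y" using Pi[OF m] by (subst retr_eq) (simp_all add: cyl_def)
  then show ?thesis by blast
qed

lemma retr_range: "\<exists>k. range (retr n) \<subseteq> P k ` cball 0 (real k)"
proof -
  obtain k t where n: "n = k\<^sup>2 + t" "t \<le> 2 * k" by (rule retr_index)
  have "retr n x \<in> P (Suc k) ` cball 0 (real (Suc k))" for x
  proof -
    have "retr n x \<in> body k" unfolding n(1) by (rule retr_in_body[OF n(2)])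
    then have "P (Suc k) (retr n x) = retr n x" "norm (P (Suc k) (retr n x)) \<le> real (Suc k)"
      unfolding body_def by blast+
    then show ?thesis by (metis image_eqI mem_cball_0)
  qed
  then show ?thesis by blast
qed

end

section \<open>Retractions of a rooted tree\<close>

text \<open>
  The first ancestor of \<open>i\<close> that is at most \<open>m\<close>. The test \<open>i \<le> p i\<close> makes the recursion terminate
  for every \<open>p\<close>; it only stops early if \<open>p\<close> is not decreasing.
\<close>

function ancestor :: "(nat \<Rightarrow> nat) \<Rightarrow> nat \<Rightarrow> nat \<Rightarrow> nat" where
  "ancestor p m i = (if i \<le> m \<or> i \<le> p i then i else ancestor p m (p i))"
  by pat_completeness auto
termination by (relation "Wellfounded.measure (\<lambda>(p, m, i). i)") auto

declare ancestor.simps[simp del]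

lemma ancestor_self: "i \<le> m \<Longrightarrow> ancestor p m i = i"
  by (subst ancestor.simps) simp

lemma ancestor_parent: "m < i \<Longrightarrow> p i < i \<Longrightarrow> ancestor p m i = ancestor p m (p i)"
  by (subst ancestor.simps) simp

lemma ancestor_le:
  assumes p: "\<And>i. 0 < i \<Longrightarrow> p i < i"
  shows "ancestor p m i \<le> m"
proof (induction i rule: less_induct)
  case (less i)
  show ?case
  proof (cases "i \<le> m")
    case False
    with p[of i] less[of "p i"] show ?thesis by (simp add: ancestor_parent)
  qed (simp add: ancestor_self)
qed

lemma ancestor_ancestor:
  assumes p: "\<And>i. 0 < i \<Longrightarrow> p i < i"
  shows "ancestor p m (ancestor p n i) = ancestor p (min m n) i"
proof (cases "n \<le> m")
  case True
  have "ancestor p n i \<le> m" using ancestor_le[OF p, of n i] True by simp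
  then show ?thesis using True by (simp add: ancestor_self min_absorb2)
next
  case False
  then have "ancestor p m (ancestor p n i) = ancestor p m i"
  proof (induction i rule: less_induct)
    case (less i)
    show ?case
    proof (cases "i \<le> n")
      case True
      then show ?thesis by (simp add: ancestor_self)
    next
      case False
      then have i: "n < i" "m < i" "p i < i" using less(2) p[of i] by auto
      then show ?thesis using less(1)[OF i(3) less(2)] by (simp add: ancestor_parent)
    qed
  qed
  with False show ?thesis by (simp add: min_absorb1)
qed

lemma retractional_basis_from_tree:
  fixes e :: "nat \<Rightarrow> 'a::metric_space"
  assumes e: "bij_betw e UNIV N" and p: "\<And>i. 0 < i \<Longrightarrow> p i < i"
    and lip: "\<And>m i j. dist (e (ancestor p m i)) (e (ancestor p m j)) \<le> K * dist (e i) (e j)" and K: "1 \<le> K"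
  shows "has_retractional_basis N"
proof -
  have inj: "inj e" and ran: "range e = N" using e by (auto simp: bij_betw_def)
  define idx where "idx = inv e"
  have idx: "idx (e i) = i" for i unfolding idx_def using inj by simp
  \<comment> \<open>Vertices are numbered from 0, retractions from 1: the \<open>n\<close>-th one keeps the vertices below \<open>n\<close>.\<close>
  define \<phi> where "\<phi> n x = e (ancestor p (n - 1) (idx x))" for n x
  define x where "x n = e (n - 1)" for n
  have \<phi>e: "\<phi> n (e i) = e (ancestor p (n - 1) i)" for n i unfolding \<phi>_def idx ..
  have img: "\<phi> n ` N = x ` {1..n}" if "1 \<le> n" for n
  proof (rule subset_antisym)
    have "e (ancestor p (n - 1) i) \<in> x ` {1..n}" for i
    proof (rule image_eqI[of _ _ "Suc (ancestor p (n - 1) i)"])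
      have "ancestor p (n - 1) i \<le> n - 1" by (rule ancestor_le[OF p])
      with that show "Suc (ancestor p (n - 1) i) \<in> {1..n}" by auto
    qed (simp add: x_def)
    then show "\<phi> n ` N \<subseteq> x ` {1..n}" unfolding ran[symmetric] by (auto simp: \<phi>e)
    show "x ` {1..n} \<subseteq> \<phi> n ` N"
    proof
      fix z assume "z \<in> x ` {1..n}"
      then obtain k where k: "k \<in> {1..n}" "z = e (k - 1)" unfolding x_def by auto
      then have "z = \<phi> n (e (k - 1))" unfolding \<phi>e by (subst ancestor_self) auto
      then show "z \<in> \<phi> n ` N" using ran by blast
    qed
  qed
  have comp: "\<phi> m (\<phi> n y) = \<phi> (min m n) y" if yN: "y \<in> N" for m n y
  proof -
    obtain i where y: "y = e i" using yN ran by blast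
    have "ancestor p (m - 1) (ancestor p (n - 1) i) = ancestor p (min (m - 1) (n - 1)) i"
      by (rule ancestor_ancestor) (rule p)
    also have "min (m - 1) (n - 1) = min m n - 1" by (simp add: min_def)
    finally show ?thesis unfolding y \<phi>e by simp
  qed
  have "K_retractional_basis K N \<phi>"
    unfolding K_retractional_basis_def
  proof (intro conjI allI impI ballI exI[of _ x])
    fix n :: nat assume n: "1 \<le> n"
    show "\<phi> n ` N \<subseteq> N" using ran unfolding \<phi>_def by blast
    show "\<phi> n y = y" if "y \<in> \<phi> n ` N" for y using that comp[of _ n n] by auto
    show "\<phi> n ` N = x ` {1..n}" by (rule img[OF n])
    show "K-lipschitz_on N (\<phi> n)"
    proof (rule lipschitz_onI)
      fix y z assume "y \<in> N" "z \<in> N"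
      then obtain i j where "y = e i" "z = e j" using ran by blast
      then show "dist (\<phi> n y) (\<phi> n z) \<le> K * dist y z" using lip by (simp add: \<phi>e)
    qed (use K in simp)
  next
    show "x ` {1..} = N"
    proof -
      have "x ` {1..} = e ` ((\<lambda>n. n - 1) ` {1..})" unfolding x_def by (simp add: image_image)
      also have "(\<lambda>n::nat. n - 1) ` {1..} = UNIV" by (auto intro!: image_eqI[of _ _ "Suc _"])
      finally show ?thesis using ran by simp
    qed
  qed (use comp in auto)
  with K show ?thesis unfolding has_retractional_basis_def by blast
qed

section \<open>Discretizing a chain of retractions\<close>

text \<open>
  Concatenating the lists, with every entry tagged by its level, gives a sequence that runs
  through the levels in order.
\<close>

lemma enumerate_levels:
  fixes L :: "nat \<Rightarrow> 'b list"
  assumes ne: "\<And>n. L n \<noteq> []"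
  shows "\<exists>(lev :: nat \<Rightarrow> nat) y. mono lev \<and> (\<forall>i. y i \<in> set (L (lev i))) \<and> (\<forall>n. \<forall>x\<in>set (L n). \<exists>i. lev i = n \<and> y i = x)"
proof -
  define cat where "cat n = concat (map (\<lambda>m. map (Pair m) (L m)) [0..<n])" for n
  have catS: "cat (Suc n) = cat n @ map (Pair n) (L n)" for n unfolding cat_def by simp
  have len: "n \<le> length (cat n)" for n
  proof (induction n)
    case (Suc n)
    have "1 \<le> length (L n)" using ne[of n] by (cases "L n") auto
    with Suc show ?case unfolding catS length_append length_map by linarith
  qed simp
  have stable: "cat (n + k) ! i = cat n ! i \<and> i < length (cat (n + k))" if "i < length (cat n)" for n k i
    using that by (induction k) (auto simp: catS nth_append)
  define z where "z i = cat (Suc i) ! i" for i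
  have z: "z i = cat n ! i" if "i < length (cat n)" for i n
  proof (cases "Suc i \<le> n")
    case True
    then show ?thesis unfolding z_def using stable[of i "Suc i" "n - Suc i"] len[of "Suc i"] by simp
  next
    case False
    then show ?thesis unfolding z_def using stable[of i "n" "Suc i - n"] that by simp
  qed
  have sorted: "sorted (map fst (cat n))" for n
  proof (induction n)
    case (Suc n)
    have "\<forall>a\<in>set (cat n). fst a \<le> n" unfolding cat_def by auto
    with Suc show ?case unfolding catS by (auto simp: sorted_append comp_def map_replicate_const)
  qed (simp add: cat_def)
  have memb: "a \<in> set (cat n) \<longleftrightarrow> fst a < n \<and> snd a \<in> set (L (fst a))" for a n
    unfolding cat_def by (cases a) auto
  have inr: "i < length (cat (Suc i))" for i using len[of "Suc i"] by simp
  have "mono (\<lambda>i. fst (z i))"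
  proof (rule monoI)
    fix i j :: nat assume ij: "i \<le> j"
    then have "map fst (cat (Suc j)) ! i \<le> map fst (cat (Suc j)) ! j"
      using inr[of j] by (intro sorted_nth_mono sorted) auto
    then show "fst (z i) \<le> fst (z j)" using ij inr[of j] z[of i "Suc j"] z[of j "Suc j"] by simp
  qed
  moreover have "snd (z i) \<in> set (L (fst (z i)))" for i
    using nth_mem[OF inr[of i]] memb unfolding z_def by blast
  moreover have "\<exists>i. fst (z i) = n \<and> snd (z i) = x" if "x \<in> set (L n)" for n x
  proof -
    have "(n, x) \<in> set (cat (Suc n))" using that memb by simp
    then obtain i where "i < length (cat (Suc n))" "cat (Suc n) ! i = (n, x)" by (auto simp: in_set_conv_nth)
    with z[of i "Suc n"] show ?thesis by (intro exI[of _ i]) simp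
  qed
  ultimately show ?thesis
    by (intro exI[of _ "\<lambda>i. fst (z i)"] exI[of _ "\<lambda>i. snd (z i)"]) blast
qed

text \<open>
  The vertices of level \<open>n\<close> form a \<open>2\<^sup>-\<^sup>n\<close>-net of the range of \<open>\<Phi> n\<close>, and the parent of a vertex
  \<open>i\<close> of level \<open>n + 1\<close> is a vertex near \<open>\<Phi> n (y i)\<close>. Rounding errors are not amplified along a
  path of ancestors: the error made at level \<open>l\<close> is transported by a single map \<open>\<Phi> n\<close>, since
  \<open>\<Phi> n \<circ> \<Phi> l = \<Phi> n\<close>. So the errors add up to at most \<open>2 * L\<close>, and the first ancestor of \<open>i\<close> that
  is at most \<open>m\<close> is a bounded distance away from \<open>\<Phi> (lev m) (y i)\<close>. If \<open>m\<close> is not the last vertex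
  of its level, this ancestor may be in the level before; this costs the step \<open>D\<close>.
\<close>

lemma discretize_retractions:
  fixes \<Phi> :: "nat \<Rightarrow> 'a::metric_space \<Rightarrow> 'a"
  assumes lip: "\<And>n x y. dist (\<Phi> n x) (\<Phi> n y) \<le> L * dist x y" and L: "0 \<le> L"
    and idem: "\<And>n x. \<Phi> n (\<Phi> n x) = \<Phi> n x"
    and down: "\<And>n x. \<Phi> n (\<Phi> (Suc n) x) = \<Phi> n x" and up: "\<And>n x. \<Phi> (Suc n) (\<Phi> n x) = \<Phi> n x"
    and step: "\<And>n x. dist (\<Phi> (Suc n) x) (\<Phi> n x) \<le> D"
    and const: "\<And>x. \<Phi> 0 x = a"
    and net: "\<And>n e. 0 < e \<Longrightarrow> \<exists>F. finite F \<and> F \<subseteq> range (\<Phi> n) \<and> (\<forall>x\<in>range (\<Phi> n). \<exists>y\<in>F. dist x y < e)"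
  shows "\<exists>(y :: nat \<Rightarrow> 'a) p K. (\<forall>i>0. p i < i) \<and>
    (\<forall>m i j. dist (y (ancestor p m i)) (y (ancestor p m j)) \<le> L * dist (y i) (y j) + K) \<and>
    (\<forall>n x. \<exists>i. dist (y i) (\<Phi> n x) < 1)"
proof -
  have downk: "\<Phi> m (\<Phi> (m + k) x) = \<Phi> m x" for m k x
  proof (induction k arbitrary: x)
    case 0
    then show ?case by (simp add: idem)
  next
    case (Suc k)
    have "\<Phi> m (\<Phi> (m + Suc k) x) = \<Phi> m (\<Phi> (m + k) (\<Phi> (m + Suc k) x))" by (simp only: Suc)
    also have "\<dots> = \<Phi> m (\<Phi> (m + k) x)" by (simp add: down)
    finally show ?case by (simp only: Suc)
  qed
  have upk: "\<Phi> (m + k) (\<Phi> m x) = \<Phi> m x" for m k x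
  proof (induction k)
    case 0
    then show ?case by (simp add: idem)
  next
    case (Suc k)
    have "\<Phi> (m + Suc k) (\<Phi> m x) = \<Phi> (Suc (m + k)) (\<Phi> (m + k) (\<Phi> m x))" by (simp only: Suc add_Suc_right)
    also have "\<dots> = \<Phi> (m + k) (\<Phi> m x)" by (rule up)
    finally show ?case by (simp only: Suc)
  qed
  have "\<forall>n. \<exists>xs. set xs \<subseteq> range (\<Phi> n) \<and> (\<forall>x. \<exists>y\<in>set xs. dist (\<Phi> n x) y < (1 / 2) ^ n)"
  proof
    fix n
    obtain F where F: "finite F" "F \<subseteq> range (\<Phi> n)" "\<forall>x\<in>range (\<Phi> n). \<exists>y\<in>F. dist x y < (1 / 2) ^ n"
      using net[of "(1 / 2) ^ n" n] by auto
    obtain xs where "set xs = F" using F(1) finite_list by blast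
    with F(2,3) show "\<exists>xs. set xs \<subseteq> range (\<Phi> n) \<and> (\<forall>x. \<exists>y\<in>set xs. dist (\<Phi> n x) y < (1 / 2) ^ n)"
      by (intro exI[of _ xs]) auto
  qed
  then obtain xs where xs: "\<And>n. set (xs n) \<subseteq> range (\<Phi> n)" "\<And>n x. \<exists>y\<in>set (xs n). dist (\<Phi> n x) y < (1 / 2) ^ n"
    by metis
  have "xs n \<noteq> []" for n using xs(2)[of n] by auto
  from enumerate_levels[of xs, OF this] obtain lev :: "nat \<Rightarrow> nat" and y :: "nat \<Rightarrow> 'a" where enum:
    "mono lev \<and> (\<forall>i. y i \<in> set (xs (lev i))) \<and> (\<forall>n. \<forall>x\<in>set (xs n). \<exists>i. lev i = n \<and> y i = x)"
    by blast
  then have lev: "mono lev" and y: "y i \<in> set (xs (lev i))"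
    and onto: "x \<in> set (xs n) \<Longrightarrow> \<exists>i. lev i = n \<and> y i = x" for i n x
    by blast+
  have fix_lev: "\<Phi> n (y i) = y i" if "lev i \<le> n" for n i
  proof -
    obtain x where x: "y i = \<Phi> (lev i) x" using y[of i] xs(1)[of "lev i"] by auto
    show ?thesis unfolding x using upk[of "lev i" "n - lev i" x] that by simp
  qed
  have ex_parent: "\<exists>j. lev j = l \<and> dist (\<Phi> l (y i)) (y j) < (1 / 2) ^ l" for l i
    using xs(2)[of l "y i"] onto[of _ l] by metis
  \<comment> \<open>Within level 0 the root can serve as parent without error, because \<open>\<Phi> 0\<close> is constant.\<close>
  define p where "p i = (if lev i = 0 then 0 else
      SOME j. lev j = lev i - 1 \<and> dist (\<Phi> (lev i - 1) (y i)) (y j) < (1 / 2) ^ (lev i - 1))" for i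
  have p: "lev (p i) = l" "dist (\<Phi> l (y i)) (y (p i)) < (1 / 2) ^ l" if "lev i = Suc l" for i l
    using someI_ex[OF ex_parent[of l i]] that by (simp_all add: p_def)
  have before: "i < j" if "lev i < lev j" for i j
    using monoD[OF lev, of j i] that by (meson leI leD)
  have p_less: "p i < i" if "0 < i" for i
  proof (cases "lev i")
    case 0
    then show ?thesis using that by (simp add: p_def)
  next
    case (Suc l)
    have "lev (p i) < lev i" using p(1)[OF Suc] Suc by simp
    then show ?thesis by (rule before)
  qed
  have D: "0 \<le> D" using step[of 0 a] zero_le_dist order_trans by blast
  define err where "err n = 1 + D + L * (\<Sum>l<n. (1 / 2) ^ l)" for n
  have err_Suc: "err (Suc n) = err n + L * (1 / 2) ^ n" for n unfolding err_def by (simp add: distrib_left)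
  have err_ge: "1 + D \<le> err n" for n unfolding err_def using L by (simp add: sum_nonneg)
  have err_le: "err n \<le> 1 + D + 2 * L" for n
  proof -
    have "(\<Sum>l<n. (1 / 2 :: real) ^ l) \<le> 2" by (simp add: sum_gp_strict)
    then have "L * (\<Sum>l<n. (1 / 2) ^ l) \<le> L * 2" using L by (intro mult_left_mono)
    then show ?thesis unfolding err_def by simp
  qed
  have key: "dist (y (ancestor p m i)) (\<Phi> (lev m) (y i)) \<le> err (lev i)" for m i
  proof (induction i rule: less_induct)
    case (less i)
    have pos: "0 \<le> err k" for k using err_ge[of k] D by linarith
    show ?case
    proof (cases "i \<le> m")
      case True
      then have "lev i \<le> lev m" using lev by (rule monoD[rotated])
      with True pos show ?thesis by (simp add: ancestor_self fix_lev)
    next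
      case False
      then have mi: "m < i" "lev m \<le> lev i" "p i < i" using lev p_less[of i] by (auto intro: monoD)
      show ?thesis
      proof (cases "lev i")
        case 0
        have "ancestor p m i \<le> m" by (rule ancestor_le) (rule p_less)
        then have "lev (ancestor p m i) \<le> lev m" using lev by (rule monoD[rotated])
        then have "lev (ancestor p m i) = 0" "lev m = 0" using 0 mi(2) by auto
        then have "y (ancestor p m i) = \<Phi> 0 (y (ancestor p m i))" by (simp add: fix_lev)
        then show ?thesis using \<open>lev m = 0\<close> pos const by simp
      next
        case (Suc l)
        have anc: "ancestor p m i = ancestor p m (p i)" using mi by (simp add: ancestor_parent)
        show ?thesis
        proof (cases "lev m \<le> l")
          case True
          have "dist (\<Phi> (lev m) (y (p i))) (\<Phi> (lev m) (y i)) = dist (\<Phi> (lev m) (y (p i))) (\<Phi> (lev m) (\<Phi> l (y i)))"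
            using downk[of "lev m" "l - lev m" "y i"] True by simp
          also have "\<dots> \<le> L * dist (y (p i)) (\<Phi> l (y i))" by (rule lip)
          also have "\<dots> \<le> L * (1 / 2) ^ l" using p(2)[OF Suc] L by (intro mult_left_mono) (auto simp: dist_commute)
          finally have "dist (y (ancestor p m i)) (\<Phi> (lev m) (y i)) \<le> err l + L * (1 / 2) ^ l"
            unfolding anc using less[OF mi(3)] p(1)[OF Suc] dist_triangle[of "y (ancestor p m (p i))" "\<Phi> (lev m) (y i)" "\<Phi> (lev m) (y (p i))"]
            by simp
          then show ?thesis using Suc err_Suc by simp
        next
          case False
          then have lm: "lev m = Suc l" using mi(2) Suc by simp
          then have "lev (p i) < lev m" using p(1)[OF Suc] by simp
          then have "p i < m" by (rule before)
          then have a: "ancestor p m i = p i" unfolding anc by (simp add: ancestor_self)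
          have "dist (y (p i)) (\<Phi> (Suc l) (y i)) \<le> dist (\<Phi> l (y i)) (y (p i)) + dist (\<Phi> (Suc l) (y i)) (\<Phi> l (y i))"
            by (metis add.commute dist_commute dist_triangle)
          also have "\<dots> \<le> 1 + D" using p(2)[OF Suc] step[of l "y i"] power_le_one[of "1 / 2 :: real" l] by simp
          finally show ?thesis unfolding a lm using err_ge[of "lev i"] by simp
        qed
      qed
    qed
  qed
  define K where "K = 2 * (1 + D + 2 * L)"
  have "dist (y (ancestor p m i)) (y (ancestor p m j)) \<le> L * dist (y i) (y j) + K" for m i j
  proof -
    have "dist (y (ancestor p m i)) (y (ancestor p m j)) \<le>
      dist (y (ancestor p m i)) (\<Phi> (lev m) (y i)) + dist (\<Phi> (lev m) (y i)) (\<Phi> (lev m) (y j))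
        + dist (y (ancestor p m j)) (\<Phi> (lev m) (y j))"
      by (smt (verit) dist_commute dist_triangle)
    also have "\<dots> \<le> (1 + D + 2 * L) + L * dist (y i) (y j) + (1 + D + 2 * L)"
      by (intro add_mono order_trans[OF key err_le] lip)
    finally show ?thesis unfolding K_def by simp
  qed
  moreover have "\<exists>i. dist (y i) (\<Phi> n x) < 1" for n x
  proof -
    obtain z where z: "z \<in> set (xs n)" "dist (\<Phi> n x) z < (1 / 2) ^ n" using xs(2) by blast
    have "(1 / 2 :: real) ^ n \<le> 1" by (simp add: power_le_one)
    with z onto[OF z(1)] show ?thesis by (metis dist_commute less_le_trans)
  qed
  ultimately show ?thesis using p_less by blast
qed

text \<open>
  The tree retractions on the vertices are Lipschitz only up to an additive constant. The vertices
  may lie close together or coincide, so this cannot be improved before they are matched with a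
  net.
\<close>

lemma L_infinity_coarse_tree:
  assumes sep: "separable_space (euclidean :: 'a::banach topology)"
    and L: "L_infinity_const_space lam TYPE('a)" and lam: "1 \<le> lam"
  shows "\<exists>(y :: nat \<Rightarrow> 'a) p M K. 0 \<le> M \<and> (\<forall>i>0. p i < i) \<and>
    (\<forall>m i j. dist (y (ancestor p m i)) (y (ancestor p m j)) \<le> M * dist (y i) (y j) + K) \<and>
    (\<forall>x. \<exists>i. dist x (y i) \<le> 2)"
proof -
  obtain P :: "nat \<Rightarrow> 'a \<Rightarrow> 'a" and c where c: "1 \<le> c" and P0: "P 0 = (\<lambda>x. 0)" and fr: "\<And>n. finite_rank (P n)"
    and bd: "\<And>n x. norm (P n x) \<le> c * norm x" and comp: "\<And>m n x. P m (P n x) = P (min m n) x"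
    and dense: "\<And>x e. 0 < e \<Longrightarrow> \<exists>n y. P n y = y \<and> dist x y < e"
    using L_infinity_projection_chain[OF sep L lam] by blast
  have "linear (P n)" for n by (rule bounded_linear.linear[OF finite_rank_bounded_linear[OF fr]])
  then interpret projection_chain P c
    using c bd comp by (intro projection_chain.intro) auto
  have net: "\<exists>F. finite F \<and> F \<subseteq> range (retr n) \<and> (\<forall>x\<in>range (retr n). \<exists>y\<in>F. dist x y < e)" if "0 < e" for n e
  proof -
    obtain k where "range (retr n) \<subseteq> P k ` cball 0 (real k)" using retr_range by blast
    moreover obtain K where "compact K" "P k ` cball 0 (real k) \<subseteq> K" using finite_rank_compact[OF fr] by blast
    ultimately show ?thesis using finite_net_within[of K "range (retr n)" e] that by blast
  qed
  have "\<exists>(y :: nat \<Rightarrow> 'a) p K. (\<forall>i>0. p i < i) \<and>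
    (\<forall>m i j. dist (y (ancestor p m i)) (y (ancestor p m j)) \<le> 10 * c\<^sup>2 * dist (y i) (y j) + K) \<and>
    (\<forall>n x. \<exists>i. dist (y i) (retr n x) < 1)"
  proof (rule discretize_retractions)
    show "dist (retr n x) (retr n y) \<le> 10 * c\<^sup>2 * dist x y" for n x y
      unfolding dist_norm by (rule retr_lipschitz)
    show "dist (retr (Suc n) x) (retr n x) \<le> 3" for n x unfolding dist_norm by (rule retr_step)
    show "retr 0 x = 0" for x using P0 by (rule retr_0)
  qed (use net in \<open>auto simp: retr_idem retr_down retr_up\<close>)
  then obtain y :: "nat \<Rightarrow> 'a" and p K where p: "\<forall>i>0. p i < i"
    and lip: "\<forall>m i j. dist (y (ancestor p m i)) (y (ancestor p m j)) \<le> 10 * c\<^sup>2 * dist (y i) (y j) + K"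
    and near: "\<And>n x. \<exists>i. dist (y i) (retr n x) < 1" by blast
  have "\<exists>i. dist x (y i) \<le> 2" for x
  proof -
    obtain m z where z: "P m z = z" "dist x z < 1" using dense[of 1 x] by auto
    obtain n where n: "retr n z = z" using retr_exhausts[OF z(1)] by blast
    obtain i where "dist (y i) z < 1" using near[of n z] n by auto
    with z(2) have "dist x (y i) \<le> 2" using dist_triangle[of x "y i" z] by (simp add: dist_commute)
    then show ?thesis by blast
  qed
  with p lip show ?thesis by (intro exI[of _ y] exI[of _ p] exI[of _ "10 * c\<^sup>2"] exI[of _ K]) simp
qed

section \<open>Matching the net with the vertices of the tree\<close>

text \<open>
  Infinitely many choices are left at each step of a greedy selection.
\<close>

lemma distinct_representatives:
  fixes A :: "nat \<Rightarrow> 'b set"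
  assumes "\<And>i. infinite (A i)"
  shows "\<exists>f. inj f \<and> (\<forall>i. f i \<in> A i)"
proof -
  have "\<exists>f. \<forall>i. (length (f i) = i \<and> distinct (f i) \<and> (\<forall>j<i. f i ! j \<in> A j)) \<and>
      (\<exists>x. f (Suc i) = f i @ [x])"
  proof (rule dependent_nat_choice)
    show "\<exists>xs :: 'b list. length xs = 0 \<and> distinct xs \<and> (\<forall>j<0. xs ! j \<in> A j)" by auto
    fix xs :: "'b list" and i
    assume xs: "length xs = i \<and> distinct xs \<and> (\<forall>j<i. xs ! j \<in> A j)"
    have "infinite (A i - set xs)" using assms by (simp add: Diff_infinite_finite)
    then have "A i - set xs \<noteq> {}" by (metis finite.emptyI)
    then obtain x where "x \<in> A i" "x \<notin> set xs" by blast
    then show "\<exists>ys. (length ys = Suc i \<and> distinct ys \<and> (\<forall>j<Suc i. ys ! j \<in> A j)) \<and> (\<exists>x. ys = xs @ [x])"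
      using xs by (intro exI[of _ "xs @ [x]"]) (auto simp: nth_append less_Suc_eq)
  qed
  then obtain F where F: "\<And>i. length (F i) = i" "\<And>i. distinct (F i)" "\<And>i j. j < i \<Longrightarrow> F i ! j \<in> A j"
    and FS: "\<And>i. \<exists>x. F (Suc i) = F i @ [x]" by blast
  define f where "f i = F (Suc i) ! i" for i
  have stable: "F n ! i = f i" if "i < n" for i n
    using that
  proof (induction n)
    case (Suc n)
    obtain x where x: "F (Suc n) = F n @ [x]" using FS by blast
    show ?case
    proof (cases "i < n")
      case True
      then show ?thesis using Suc x F(1)[of n] by (simp add: nth_append)
    next
      case False
      then have "i = n" using Suc by simp
      then show ?thesis by (simp add: f_def)
    qed
  qed simp
  have "inj f"
  proof (rule injI)
    fix i j assume eq: "f i = f j"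
    let ?n = "Suc (max i j)"
    have "F ?n ! i = F ?n ! j" using eq stable[of i ?n] stable[of j ?n] by simp
    then show "i = j" using nth_eq_iff_index_eq[OF F(2)[of ?n], of i j] F(1)[of ?n] by simp
  qed
  moreover have "f i \<in> A i" for i unfolding f_def by (rule F(3)) simp
  ultimately show ?thesis by blast
qed

text \<open>
  The bijection of Schroeder and Bernstein agrees at each point with \<open>f\<close> or with the inverse of
  \<open>g\<close>. Hence it respects every relation that \<open>f\<close> and \<open>g\<close> respect.
\<close>

lemma Schroeder_Bernstein_within:
  assumes f: "inj_on f A" "f ` A \<subseteq> B" and g: "inj_on g B" "g ` B \<subseteq> A"
    and rf: "\<And>a. a \<in> A \<Longrightarrow> r a (f a)" and rg: "\<And>b. b \<in> B \<Longrightarrow> r (g b) b"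
  shows "\<exists>h. bij_betw h A B \<and> (\<forall>a\<in>A. r a (h a))"
proof -
  define X where "X = lfp (\<lambda>X. A - (g ` (B - (f ` X))))"
  have X: "X = A - (g ` (B - (f ` X)))"
    unfolding X_def by (rule lfp_unfold) (blast intro: monoI)
  have XA: "X \<subseteq> A" using X by blast
  have comp: "A - X = g ` (B - f ` X)" using X g(2) by blast
  define g' where "g' = the_inv_into (B - f ` X) g"
  have inj: "inj_on g (B - f ` X)" using g(1) by (rule inj_on_subset) blast
  have b1: "bij_betw f X (f ` X)" using f(1) XA by (simp add: bij_betw_def inj_on_subset)
  have "bij_betw g (B - f ` X) (A - X)" using inj comp by (simp add: bij_betw_def)
  then have b2: "bij_betw g' (A - X) (B - f ` X)" unfolding g'_def by (rule bij_betw_the_inv_into)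
  define h where "h a = (if a \<in> X then f a else g' a)" for a
  have h1: "bij_betw h X (f ` X)" using b1 by (rule bij_betw_cong[THEN iffD1, rotated]) (simp add: h_def)
  have h2: "bij_betw h (A - X) (B - f ` X)" using b2 by (rule bij_betw_cong[THEN iffD1, rotated]) (simp add: h_def)
  have "bij_betw h (X \<union> (A - X)) (f ` X \<union> (B - f ` X))"
    by (rule bij_betw_combine[OF h1 h2]) blast
  moreover have "X \<union> (A - X) = A" "f ` X \<union> (B - f ` X) = B" using XA f(2) by blast+
  ultimately have "bij_betw h A B" by simp
  moreover have "r a (h a)" if a: "a \<in> A" for a
  proof (cases "a \<in> X")
    case True
    then show ?thesis using rf a by (simp add: h_def)
  next
    case False
    then have ha: "h a = g' a" by (simp add: h_def)
    have "a \<in> g ` (B - f ` X)" using a False comp by blast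
    then have "g (g' a) = a" unfolding g'_def using inj by (rule f_the_inv_into_f[rotated])
    moreover have "g' a \<in> B" using bij_betw_apply[OF h2, of a] a False ha by simp
    ultimately show ?thesis using rg[of "g' a"] ha by simp
  qed
  ultimately show ?thesis by blast
qed

text \<open>
  If only finitely many points of \<open>S\<close> were close to \<open>x\<close>, a bounded projection \<open>P\<close> would fix their
  differences to \<open>x\<close>. A vector \<open>w\<close> of norm \<open>r\<close> with \<open>P w = 0\<close> has distance at least
  \<open>r / (1 + lam)\<close> from the vectors fixed by \<open>P\<close>, so that \<open>x + w\<close> is too far from all these points
  to be covered by them.
\<close>

lemma L_infinity_infinite_cball:
  assumes L: "L_infinity_const_space lam TYPE('a::banach)" and lam: "0 \<le> lam"
    and inf: "\<not> fin_dim_subspace (UNIV :: 'a set)" and b: "0 \<le> b"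
  shows "\<exists>R. \<forall>S :: 'a set. (\<forall>x. \<exists>y\<in>S. dist x y \<le> b) \<longrightarrow> (\<forall>x. infinite (S \<inter> cball x R))"
proof -
  define r where "r = (1 + lam) * (b + 1)"
  have r: "0 < r" unfolding r_def using lam b by simp
  have "infinite (S \<inter> cball x (r + b))" if S: "\<And>x. \<exists>y\<in>S. dist x y \<le> b" for S :: "'a set" and x
  proof
    assume fin: "finite (S \<inter> cball x (r + b))"
    define A where "A = (\<lambda>s. s - x) ` (S \<inter> cball x (r + b))"
    have "finite A" unfolding A_def using fin by simp
    from L_infinity_projection[OF L this] obtain P :: "'a \<Rightarrow> 'a" where P: "finite_rank P"
      "\<And>y. norm (P y) \<le> lam * norm y" "\<And>y. P (P y) = P y" and PA: "\<And>y. y \<in> span A \<Longrightarrow> P y = y"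
      by blast
    have lin: "linear P" using finite_rank_bounded_linear[OF P(1)] by (rule bounded_linear.linear)
    obtain B where B: "finite B" "range P \<subseteq> span B" using finite_rank_range[OF P(1)] by blast
    have "span B \<noteq> UNIV" using inf B(1) unfolding fin_dim_subspace_def by blast
    then obtain v where "v \<notin> span B" by blast
    then have v: "v - P v \<noteq> 0" using B(2) by auto
    define w where "w = (r / norm (v - P v)) *\<^sub>R (v - P v)"
    have nw: "norm w = r" unfolding w_def using v r by simp
    have Pw: "P w = 0" unfolding w_def by (simp add: linear_scale[OF lin] linear_diff[OF lin] P(3))
    obtain s where s: "s \<in> S" "dist (x + w) s \<le> b" using S by blast
    have "dist x s \<le> dist x (x + w) + dist (x + w) s" by (rule dist_triangle)
    also have "dist x (x + w) = r" using nw by (simp add: dist_norm)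
    finally have "s \<in> S \<inter> cball x (r + b)" using s by simp
    then have "s - x \<in> span A" unfolding A_def by (intro span_base) blast
    then have "P (s - x) = s - x" by (rule PA)
    then have "P (w - (s - x)) = - (s - x)" by (simp add: linear_diff[OF lin] Pw)
    then have "norm (s - x) \<le> lam * norm (w - (s - x))" using P(2)[of "w - (s - x)"] by (simp add: norm_minus_commute)
    moreover have "norm w \<le> norm (w - (s - x)) + norm (s - x)" by (metis add.commute norm_triangle_sub)
    ultimately have "r \<le> (1 + lam) * norm (w - (s - x))" using nw by (simp add: distrib_right)
    also have "w - (s - x) = x + w - s" by simp
    also have "(1 + lam) * norm (x + w - s) \<le> (1 + lam) * b"
      using s(2) lam by (intro mult_left_mono) (auto simp: dist_norm)
    finally show False unfolding r_def using lam by (simp add: distrib_left)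
  qed
  then show ?thesis by blast
qed

theorem theorem2p26:
  fixes N :: "'a::banach set"
  assumes "separable_space (euclidean :: 'a topology)"
    and "\<not> fin_dim_subspace (UNIV :: 'a set)"
    and "L_infinity_space TYPE('a)"
    and "net_in (UNIV :: 'a set) N"
  shows "has_retractional_basis N"
proof -
  obtain lam where lam: "1 \<le> lam" and L: "L_infinity_const_space lam TYPE('a)"
    using assms(3) unfolding L_infinity_space_def by blast
  obtain a b where a: "0 < a" "\<And>x y. x \<in> N \<Longrightarrow> y \<in> N \<Longrightarrow> x \<noteq> y \<Longrightarrow> a \<le> dist x y"
    and b: "0 < b" "\<And>x. \<exists>y\<in>N. dist x y \<le> b"
  proof -
    have "\<exists>a>0. \<exists>b>0. (\<forall>x\<in>N. \<forall>y\<in>N. x \<noteq> y \<longrightarrow> a \<le> dist x y) \<and> (\<forall>x. \<exists>y\<in>N. dist x y \<le> b)"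
      using assms(4) by (simp add: net_in_def)
    then show ?thesis using that by blast
  qed
  obtain y :: "nat \<Rightarrow> 'a" and p M K where M: "0 \<le> M" and p: "\<And>i. 0 < i \<Longrightarrow> p i < i"
    and lip: "\<And>m i j. dist (y (ancestor p m i)) (y (ancestor p m j)) \<le> M * dist (y i) (y j) + K"
    and ydense: "\<And>x. \<exists>i. dist x (y i) \<le> 2"
    using L_infinity_coarse_tree[OF assms(1) L lam] by blast
  have "0 \<le> max b 2" by simp
  from L_infinity_infinite_cball[OF L _ assms(2) this] lam obtain R where
    R: "\<And>S x. (\<And>x. \<exists>y\<in>S. dist x y \<le> max b 2) \<Longrightarrow> infinite (S \<inter> cball (x::'a) R)"
    by auto
  \<comment> \<open>Vertices and net points have infinitely many partners each, so injections exist in both directions.\<close>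
  have infN: "infinite (N \<inter> cball x R)" for x
  proof (rule R)
    show "\<exists>y\<in>N. dist x y \<le> max b 2" for x using b(2)[of x] by (auto simp: le_max_iff_disj)
  qed
  have infy: "infinite {i. dist x (y i) \<le> R}" for x
  proof
    assume fin: "finite {i. dist x (y i) \<le> R}"
    have "infinite (range y \<inter> cball x R)"
    proof (rule R)
      show "\<exists>z\<in>range y. dist x z \<le> max b 2" for x using ydense[of x] by (auto simp: le_max_iff_disj)
    qed
    moreover have "range y \<inter> cball x R \<subseteq> y ` {i. dist x (y i) \<le> R}" by auto
    ultimately show False using fin finite_surj by blast
  qed
  have "infinite N" using infN[of 0] by auto
  have "countable N" using assms(1) a by (rule countable_separated)
  define enum where "enum = from_nat_into N"
  have enum: "bij_betw enum UNIV N"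
    unfolding enum_def using \<open>countable N\<close> \<open>infinite N\<close> by (rule bij_betw_from_nat_into)
  obtain f where f: "inj f" "\<And>i. f i \<in> N \<inter> cball (y i) R"
    using distinct_representatives[of "\<lambda>i. N \<inter> cball (y i) R"] infN by auto
  obtain g where g: "inj g" "\<And>i. g i \<in> {j. dist (enum i) (y j) \<le> R}"
    using distinct_representatives[of "\<lambda>i. {j. dist (enum i) (y j) \<le> R}"] infy by auto
  define g' where "g' x = g (inv enum x)" for x
  have inj_inv: "inj_on (inv enum) N"
    using enum by (metis bij_betw_def inj_on_inv_into subset_UNIV order_refl)
  have "\<exists>h. bij_betw h UNIV N \<and> (\<forall>i\<in>UNIV. dist (h i) (y i) \<le> R)"
  proof (rule Schroeder_Bernstein_within)
    show "inj f" "range f \<subseteq> N" using f by auto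
    show "inj_on g' N" unfolding g'_def using inj_inv g(1) by (auto simp: inj_on_def)
    show "g' ` N \<subseteq> UNIV" by simp
    show "dist (f i) (y i) \<le> R" for i using f(2)[of i] by (simp add: dist_commute)
    show "dist x (y (g' x)) \<le> R" if "x \<in> N" for x
    proof -
      have "enum (inv enum x) = x" using enum that by (auto simp: bij_betw_def f_inv_into_f)
      then show ?thesis unfolding g'_def using g(2)[of "inv enum x"] by simp
    qed
  qed
  then obtain e where e: "bij_betw e UNIV N" "\<And>i. dist (e i) (y i) \<le> R" by blast
  \<comment> \<open>The additive error \<open>C\<close> is absorbed because different points of \<open>N\<close> have distance at least \<open>a\<close>.\<close>
  define C where "C = 2 * R + K + 2 * R * M"
  define K' where "K' = M + \<bar>C\<bar> / a + 1"
  have "dist (e (ancestor p m i)) (e (ancestor p m j)) \<le> K' * dist (e i) (e j)" for m i j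
  proof (cases "e i = e j")
    case True
    then have "i = j" using e(1) by (auto simp: bij_betw_def inj_on_def)
    then show ?thesis by simp
  next
    case False
    define d where "d = dist (e i) (e j)"
    have "e i \<in> N" "e j \<in> N" using e(1) by (auto simp: bij_betw_def)
    then have d: "a \<le> d" unfolding d_def using a(2) False by blast
    have near: "dist (e i) (e j) \<le> dist (y i) (y j) + 2 * R" "dist (y i) (y j) \<le> dist (e i) (e j) + 2 * R" for i j
      using e(2)[of i] e(2)[of j] by (smt (verit) dist_commute dist_triangle)+
    have "dist (e (ancestor p m i)) (e (ancestor p m j)) \<le> M * dist (y i) (y j) + K + 2 * R"
      using near(1) lip by (smt (verit))
    also have "\<dots> \<le> M * (d + 2 * R) + K + 2 * R"
      unfolding d_def using M near(2) by (intro add_right_mono mult_left_mono)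
    also have "\<dots> = M * d + C" unfolding C_def by (simp add: algebra_simps)
    also have "C \<le> \<bar>C\<bar> / a * d"
    proof -
      have "\<bar>C\<bar> / a * a \<le> \<bar>C\<bar> / a * d" using d a(1) by (intro mult_left_mono) auto
      then show ?thesis using a(1) by simp
    qed
    also have "M * d + \<bar>C\<bar> / a * d \<le> K' * d" unfolding K'_def using d a(1) by (simp add: distrib_right)
    finally show ?thesis unfolding d_def by simp
  qed
  moreover have "1 \<le> K'" unfolding K'_def using M a(1) by simp
  ultimately show ?thesis using retractional_basis_from_tree[OF e(1) p] by blast
qed

end
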